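(* Let $f$ and $A_0$ be as in the context and, for $\rho>0$ small, let $\mathcal S=\mathcal S_\rho$, $\mathcal S(\varphi,\psi)=(\varphi+\rho f(\varphi,\psi),A_0\psi)$, and let $W=W_\rho$ describe its invariant manifold. Fix $\varphi\in\mathcal U$. For $t\ge0$ set $k=\lfloor t/\rho\rfloor$ and define, for $\psi\in\mathbb T^2$, $$X_t(\psi)=(\mathcal S^{k})_\varphi(\varphi,\psi)+(t/\rho-k)\bigl((\mathcal S^{k+1})_\varphi(\varphi,\psi)-(\mathcal S^{k})_\varphi(\varphi,\psi)\bigr),$$ $$\mathcal X_t(\psi)=X_t(\psi)-W(A_0^{k}\psi)-(t/\rho-k)\bigl(W(A_0^{k+1}\psi)-W(A_0^{k}\psi)\bigr),$$ viewed as stochastic processes on the probability space $(\mathbb T^2,m_0)$ with continuous trajectories in $t\ge 0$. Let $\Phi_t=\Phi_t(\varphi)$ be the solution of $\frac{d}{dt}\Phi_t(\varphi)=\overline f(\Phi_t(\varphi))$, $\Phi_0(\varphi)=\varphi$, with $\overline f(\varphi)=\langle f(\varphi,\cdot)\rangle$. Then, for any $\xi\in[0,\gamma)$, $\mathcal X_t\to\Phi_t$ as $\rho\to0^+$ in probability in the topology generated by the norm $\|x\|^{\exp}_\xi=\sup_{t\ge0}e^{\xi t}|x(t)|$; that is, for every $\delta>0$, $$\lim_{\rho\to0^+}m_0\Bigl(\Bigl\{\psi\in\mathbb T^2:\ \sup_{t\ge0}e^{\xi t}|\mathcal X_t(\psi)-\Phi_t(\varphi)|>\delta\Bigr\}\Bigr)=0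 .$$
   Context: $\mathbb T=\mathbb R/2\pi\mathbb Z$. $A_0$ is an Anosov (hyperbolic linear) automorphism of $\mathbb T^2$. $m_0(d\psi)=d\psi/(2\pi)^2$ and $\langle g\rangle=\int_{\mathbb T^2}g\,dm_0$. The subscript $\varphi$ denotes the first component of a map. For $\alpha\in(0,1]$, $k\ge1$, and $g(\varphi,\psi)$ on $\mathbb T\times\mathbb T^2$: $|g|_\alpha=\sup|g(\varphi,\psi')-g(\varphi,\psi)|/|\psi'-\psi|^\alpha$, and $\mathscr B_{\alpha,k}$ is the space of functions $k$ times continuously differentiable in $\varphi$ with $|||g|||_{\alpha,k}=\sum_{n=0}^k\|\partial_\varphi^ng\|_\infty+\alpha\sum_{n=0}^{k-1}|\partial_\varphi^ng|_\alpha<\infty$. Standing assumptions: $f\in\mathscr B_{\alpha_0,6}(\mathbb T\times\mathbb T^2,\mathbb R)$ for some $\alpha_0\in(0,1]$, $|||f|||_{\alpha_0,6}=1$; there is a closed interval $\mathcal U=[\phi_m,\phi_M]\subsetneq\mathbb T$, $\phi_m<\phi_M$ (identified with an interval of $\mathbb R$), with $\Omega=\mathcal U\times\mathbb T^2$, such that $f(\phi_m,\psi)>0>f(\phi_M,\psi)$ for all $\psi$; for every $\psi$ there is a unique $S(\psi)\in\operatorname{int}\mathcal U$ with $f(S(\psi),\psi)=0$; with $S_m=\inf_\psi S$, $S_M=\sup_\psi S$, $\Lambda=[S_m,S_M]\times\mathbb T^2$, one has $\gamma:=-\sup_{\Lambda}\partial_\varphi f>0$. The parametrization of $\mathbb T$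 is such that $0\in[S_m,S_M]$ is the unique zero of $\overline f$ in $\mathcal U$. For $\rho$ small, $1+\rho\,\partial_\varphi f>0$ on $\Omega$, $\mathcal S(\Omega)\subset\Omega$ (as a subset of $\mathbb R\times\mathbb T^2$), and there is a unique $W:\mathbb T^2\to\mathbb R$ with graph in $\Lambda$ such that $\mathcal S(W(\psi),\psi)=(W(A_0\psi),A_0\psi)$ for all $\psi$. *)

theory Defs
  imports "HOL-Analysis.Analysis"
begin

text \<open>Points of \<open>\<T> = \<real>/2\<pi>\<int>\<close> and \<open>\<T>\<^sup>2\<close> are represented by their lifts to \<open>\<real>\<close> and
  \<open>\<real>\<^sup>2\<close>; functions on a torus are the corresponding \<open>2\<pi>\<close>-periodic functions.\<close>

definition torus_lattice :: "(real^2) set" where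
  "torus_lattice = {v. \<forall>i. \<exists>n::int. v $ i = 2 * pi * of_int n}"

definition torus_fun :: "(real^2 \<Rightarrow> 'a) \<Rightarrow> bool" where
  "torus_fun g \<longleftrightarrow> (\<forall>\<psi>. \<forall>v\<in>torus_lattice. g (\<psi> + v) = g \<psi>)"

definition torus3_fun :: "(real \<Rightarrow> real^2 \<Rightarrow> 'a) \<Rightarrow> bool" where
  "torus3_fun g \<longleftrightarrow> (\<forall>\<phi>. torus_fun (g \<phi>)) \<and> (\<forall>\<phi> \<psi>. g (\<phi> + 2 * pi) \<psi> = g \<phi> \<psi>)"

definition torus_dist :: "real^2 \<Rightarrow> real^2 \<Rightarrow> real" where
  "torus_dist \<psi> \<psi>' = infdist (\<psi>' - \<psi>) torus_lattice"

text \<open>The measure \<open>d\<psi> / (2\<pi>)\<^sup>2\<close>, carried by one fundamental domain of \<open>\<T>\<^sup>2\<close>.\<close>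

definition m0 :: "(real^2) measure" where
  "m0 = density lborel (\<lambda>\<psi>. ennreal (indicator {\<psi>. \<forall>i. 0 \<le> \<psi> $ i \<and> \<psi> $ i < 2 * pi} \<psi> / (2 * pi)\<^sup>2))"

definition avg :: "(real \<Rightarrow> real^2 \<Rightarrow> real) \<Rightarrow> real \<Rightarrow> real" where
  "avg f \<phi> = (LINT \<psi>|m0. f \<phi> \<psi>)"

text \<open>An integer matrix with determinant \<open>\<plusminus>1\<close> induces an automorphism of \<open>\<T>\<^sup>2\<close>;
  it is Anosov iff no complex eigenvalue lies on the unit circle.\<close>

definition anosov_automorphism :: "real^2^2 \<Rightarrow> bool" where
  "anosov_automorphism A \<longleftrightarrow>
     (\<forall>i j. A $ i $ j \<in> \<int>) \<and> \<bar>det A\<bar> = 1 \<and>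
     (\<forall>(c::complex) v. v \<noteq> 0 \<longrightarrow> (\<chi> i j. complex_of_real (A $ i $ j)) *v v = c *s v \<longrightarrow> norm c \<noteq> 1)"

definition dphi :: "nat \<Rightarrow> (real \<Rightarrow> real^2 \<Rightarrow> real) \<Rightarrow> real \<Rightarrow> real^2 \<Rightarrow> real" where
  "dphi n g \<phi> \<psi> = (deriv ^^ n) (\<lambda>x. g x \<psi>) \<phi>"

definition sup_norm :: "(real \<Rightarrow> real^2 \<Rightarrow> real) \<Rightarrow> ennreal" where
  "sup_norm g = (SUP (\<phi>, \<psi>)\<in>UNIV. ennreal \<bar>g \<phi> \<psi>\<bar>)"

text \<open>Pairs at distance 0 are the same point of the torus and contribute \<open>0/0 = 0\<close>.\<close>

definition holder_seminorm :: "real \<Rightarrow> (real \<Rightarrow> real^2 \<Rightarrow> real) \<Rightarrow> ennreal" where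
  "holder_seminorm \<alpha> g =
     (SUP (\<phi>, \<psi>, \<psi>')\<in>UNIV. ennreal (\<bar>g \<phi> \<psi>' - g \<phi> \<psi>\<bar> / torus_dist \<psi> \<psi>' powr \<alpha>))"

definition B_norm :: "real \<Rightarrow> nat \<Rightarrow> (real \<Rightarrow> real^2 \<Rightarrow> real) \<Rightarrow> ennreal" where
  "B_norm \<alpha> k g =
     (\<Sum>n\<le>k. sup_norm (dphi n g)) + ennreal \<alpha> * (\<Sum>n<k. holder_seminorm \<alpha> (dphi n g))"

definition B_space :: "real \<Rightarrow> nat \<Rightarrow> (real \<Rightarrow> real^2 \<Rightarrow> real) set" where
  "B_space \<alpha> k = {g. torus3_fun g \<and>
     (\<forall>\<psi>. (\<forall>n<k. \<forall>\<phi>. (\<lambda>x. dphi n g x \<psi>) differentiable at \<phi>) \<and>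
          continuous_on UNIV (\<lambda>x. dphi k g x \<psi>)) \<and>
     B_norm \<alpha> k g < \<infinity>}"

definition skew_map ::
  "(real \<Rightarrow> real^2 \<Rightarrow> real) \<Rightarrow> real^2^2 \<Rightarrow> real \<Rightarrow> real \<times> (real^2) \<Rightarrow> real \<times> (real^2)" where
  "skew_map f A \<rho> = (\<lambda>(\<phi>, \<psi>). (\<phi> + \<rho> * f \<phi> \<psi>, A *v \<psi>))"

definition invariant_graph ::
  "(real \<Rightarrow> real^2 \<Rightarrow> real) \<Rightarrow> real^2^2 \<Rightarrow> real \<Rightarrow> real set \<Rightarrow> (real^2 \<Rightarrow> real) \<Rightarrow> bool" where
  "invariant_graph f A \<rho> I W \<longleftrightarrow> torus_fun W \<and>
     (\<forall>\<psi>. W \<psi> \<in> I \<and> skew_map f A \<rho> (W \<psi>, \<psi>) = (W (A *v \<psi>), A *v \<psi>))"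

definition X_proc ::
  "(real \<Rightarrow> real^2 \<Rightarrow> real) \<Rightarrow> real^2^2 \<Rightarrow> real \<Rightarrow> real \<Rightarrow> real \<Rightarrow> real^2 \<Rightarrow> real" where
  "X_proc f A \<rho> \<phi> t \<psi> =
     (let k = nat \<lfloor>t / \<rho>\<rfloor>; x = (\<lambda>j. fst ((skew_map f A \<rho> ^^ j) (\<phi>, \<psi>)))
      in x k + (t / \<rho> - real k) * (x (Suc k) - x k))"

definition calX_proc ::
  "(real \<Rightarrow> real^2 \<Rightarrow> real) \<Rightarrow> real^2^2 \<Rightarrow> real \<Rightarrow> (real^2 \<Rightarrow> real) \<Rightarrow> real \<Rightarrow> real \<Rightarrow> real^2 \<Rightarrow> real" where
  "calX_proc f A \<rho> W \<phi> t \<psi> =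
     (let k = nat \<lfloor>t / \<rho>\<rfloor>; w = (\<lambda>j. W ((((*v) A) ^^ j) \<psi>))
      in X_proc f A \<rho> \<phi> t \<psi> - w k - (t / \<rho> - real k) * (w (Suc k) - w k))"

text \<open>Extended-real valued, since the supremum may be infinite.\<close>

definition exp_norm :: "real \<Rightarrow> (real \<Rightarrow> real) \<Rightarrow> ereal" where
  "exp_norm \<xi> x = (SUP t\<in>{0..}. ereal (exp (\<xi> * t) * \<bar>x t\<bar>))"

end

theory Submission
  imports Defs
begin

text \<open>Both the slow orbit \<open>x\<^sub>k\<close> and the orbit \<open>w\<^sub>k = W (A\<^sup>k \<psi>)\<close> on the invariant graph obey the same
  recursion, so \<open>x\<^sub>k - w\<^sub>k\<close> decays like \<open>exp (- \<kappa> \<rho> k)\<close> for every \<open>\<kappa> < \<gamma>\<close>, uniformly in \<open>\<psi>\<close>: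
  \<open>x\<^sub>k\<close> needs \<open>O(1/\<rho>)\<close> steps to come close to the strip where the map contracts. It remains to treat
  a bounded time interval (the decay of \<open>\<Phi>\<close> then follows by passing to the limit).

  There everything reduces to a maximal weak law of large numbers for the sums
  \<open>\<Sum>j<k. f (z\<^sub>j) (A\<^sup>j \<psi>) - avg f (z\<^sub>j)\<close> with deterministic \<open>z\<^sub>j\<close>: distinct characters are orthogonal and
  hyperbolicity makes \<open>j \<mapsto> k A\<^sup>j\<close> injective for \<open>k \<noteq> 0\<close>, so trigonometric polynomials have second
  moments \<open>O(n)\<close>, and \<open>f\<close> is approximated uniformly by Stone-Weierstrass. Taking \<open>z\<^sub>j = \<Phi> (\<rho> j)\<close> and a
  discrete Gronwall argument gives \<open>x\<^sub>k \<approx> \<Phi> (\<rho> k)\<close>. Taking \<open>z\<^sub>j = 0\<close> and starting the orbit on the graph at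
  \<open>A\<^sup>-\<^sup>N \<psi>\<close>, whose initial value is forgotten exponentially fast, gives \<open>w\<^sub>k \<approx> 0\<close>.\<close>

section \<open>Characters of the torus\<close>

text \<open>Fubini for product functions. Lebesgue measure on \<open>real^'n\<close> is the image of
  a product measure indexed by the basis vectors, and \<open>ax\<close> translates that index set
  into \<open>'n\<close>.\<close>

lemma integral_lborel_vec_prod:
  fixes g :: "'n::finite \<Rightarrow> real \<Rightarrow> complex"
  assumes "\<And>i. integrable lborel (g i)"
  shows "(LINT x|lborel. (\<Prod>i\<in>UNIV. g i (x $ i))) = (\<Prod>i\<in>UNIV. LINT x|lborel. g i x)"
proof -
  define ax where "ax = (\<lambda>i::'n. axis i (1::real))"
  interpret product_sigma_finite "\<lambda>_::real^'n. lborel :: real measure" ..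
  have inj: "inj ax" by (simp add: inj_def axis_eq_axis ax_def)
  have Basis: "(Basis :: (real^'n) set) = range ax" by (auto simp: Basis_vec_def ax_def)
  have comp: "(\<Sum>b\<in>Basis. F b *\<^sub>R b) $ i = F (ax i)" for F :: "real^'n \<Rightarrow> real" and i
  proof -
    have "(\<Sum>b\<in>Basis. F b *\<^sub>R b) $ i = (\<Sum>b\<in>Basis. F b *\<^sub>R b) \<bullet> ax i"
      by (simp add: ax_def inner_axis)
    also have "\<dots> = F (ax i)" by (rule inner_sum_left_Basis) (simp add: Basis)
    finally show ?thesis .
  qed
  have meas [measurable]: "g i \<in> borel_measurable borel" for i
    using borel_measurable_integrable[OF assms[of i]] by simp
  have "(LINT x|lborel. (\<Prod>i\<in>UNIV. g i (x $ i)))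
      = (LINT F|(\<Pi>\<^sub>M b\<in>(Basis::(real^'n) set). lborel). (\<Prod>i\<in>UNIV. g i ((\<Sum>b\<in>Basis. F b *\<^sub>R b) $ i)))"
  proof (subst lborel_eq, subst integral_distr)
    have "(\<lambda>x::real^'n. x $ i) \<in> borel_measurable borel" for i
      by (intro borel_measurable_continuous_onI continuous_intros)
    then show "(\<lambda>x. \<Prod>i\<in>UNIV. g i (x $ i)) \<in> borel_measurable borel"
      by measurable
  qed simp_all
  also have "\<dots> = (LINT F|(\<Pi>\<^sub>M b\<in>(Basis::(real^'n) set). lborel). (\<Prod>b\<in>Basis. g (inv ax b) (F b)))"
    unfolding comp unfolding Basis by (simp add: prod.reindex[OF inj] inv_f_f[OF inj])
  also have "\<dots> = (\<Prod>b\<in>(Basis::(real^'n) set). LINT x|lborel. g (inv ax b) x)"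
    by (rule product_integral_prod) (auto simp: assms)
  also have "\<dots> = (\<Prod>i\<in>UNIV. LINT x|lborel. g i x)"
    unfolding Basis by (simp add: prod.reindex[OF inj] inv_f_f[OF inj])
  finally show ?thesis .
qed

section \<open>Normalised Lebesgue measure on the torus\<close>

lemma sets_m0 [simp, measurable_cong]: "sets m0 = sets borel"
  and space_m0 [simp]: "space m0 = UNIV"
  by (simp_all add: m0_def)

text \<open>The fundamental domain is a product of half-open intervals, so the density splits into
  one factor per coordinate. Closing each interval adds a null set and suits the fundamental theorem
  of calculus.\<close>

lemma integral_m0_prod:
  fixes g :: "2 \<Rightarrow> real \<Rightarrow> complex"
  assumes cont: "\<And>i. continuous_on UNIV (g i)"
  shows "(LINT \<psi>|m0. (\<Prod>i\<in>UNIV. g i (\<psi> $ i)))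
       = (\<Prod>i\<in>UNIV. (LINT x|lborel. indicator {0..2*pi} x *\<^sub>R g i x) / (2 * pi))"
proof -
  define h where "h i x = (indicator {0..<2*pi} x / (2*pi)) *\<^sub>R g i x" for i x
  have [measurable]: "g i \<in> borel_measurable borel" for i
    using cont by (intro borel_measurable_continuous_onI)
  have int0: "integrable lborel (\<lambda>x. indicator {0..2*pi} x *\<^sub>R g i x)" for i
    by (intro borel_integrable_compact continuous_on_subset[OF cont]) auto
  have ae: "AE x in lborel. (indicator {0..2*pi} x *\<^sub>R g i x) / (2*pi) = h i x" for i
    using AE_lborel_singleton[of "2*pi"] by eventually_elim (auto simp: h_def indicator_def scaleR_conv_of_real)
  have [measurable]: "h i \<in> borel_measurable borel" for i
    unfolding h_def by measurable
  have inth: "integrable lborel (h i)" for i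
    by (rule integrable_cong_AE_imp[OF integrable_divide[OF int0] _ ae]) simp
  have inth_eq: "(LINT x|lborel. h i x) = (LINT x|lborel. indicator {0..2*pi} x *\<^sub>R g i x) / (2 * pi)" for i
    by (subst integral_cong_AE[OF _ _ ae[of i], symmetric]) (auto simp: h_def)
  have "(LINT \<psi>|m0. (\<Prod>i\<in>UNIV. g i (\<psi> $ i)))
      = (LINT \<psi>|lborel. (indicator {\<psi>. \<forall>i. 0 \<le> \<psi> $ i \<and> \<psi> $ i < 2 * pi} \<psi> / (2 * pi)\<^sup>2) *\<^sub>R (\<Prod>i\<in>UNIV. g i (\<psi> $ i)))"
    unfolding m0_def by (rule integral_density) auto
  also have "\<dots> = (LINT \<psi>|lborel. (\<Prod>i\<in>UNIV. h i (\<psi> $ i)))"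
    by (intro Bochner_Integration.integral_cong)
       (auto simp: h_def indicator_def UNIV_2 power2_eq_square scaleR_conv_of_real forall_2)
  also have "\<dots> = (\<Prod>i\<in>UNIV. LINT x|lborel. h i x)"
    by (rule integral_lborel_vec_prod[OF inth])
  finally show ?thesis unfolding inth_eq .
qed

lemma emeasure_m0_UNIV: "emeasure m0 UNIV = 1"
proof -
  have "complex_of_real (measure m0 UNIV) = (LINT \<psi>|m0. (\<Prod>i\<in>(UNIV::2 set). 1))"
    by (simp add: scaleR_conv_of_real)
  also have "\<dots> = 1"
    by (subst integral_m0_prod) (auto simp: scaleR_conv_of_real)
  finally have "measure m0 UNIV = 1" by (metis of_real_eq_1_iff)
  \<comment> \<open>An infinite \<open>emeasure\<close> would make \<open>measure\<close> equal to
    0, so the value 1 rules it out.\<close>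
  then show ?thesis
    by (cases "emeasure m0 UNIV") (auto simp: measure_def ennreal_1)
qed

interpretation m0: finite_measure m0
  by standard (simp add: emeasure_m0_UNIV)

lemma measure_m0_UNIV [simp]: "measure m0 UNIV = 1"
  by (simp add: measure_def emeasure_m0_UNIV)

text \<open>The frequencies: the characters of the torus are the functions
  \<open>cis (k \<bullet> \<psi>)\<close> with \<open>k\<close> integral.\<close>

definition int_vec :: "real^'n \<Rightarrow> bool" where
  "int_vec k \<longleftrightarrow> (\<forall>i. k $ i \<in> \<int>)"

lemma integral_cis_period:
  assumes "n \<in> \<int>" "n \<noteq> 0"
  shows "(LINT x|lborel. indicator {0..2*pi} x *\<^sub>R cis (n * x)) = 0"
proof -
  have "(LINT x|lborel. indicator {0..2*pi} x *\<^sub>R cis (n * x))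
      = cis (n * (2 * pi)) / (\<i> * n) - cis (n * 0) / (\<i> * n)"
  proof (rule integral_FTC_atLeastAtMost)
    show "((\<lambda>x. cis (n * x) / (\<i> * n)) has_vector_derivative cis (n * x)) (at x within {0..2*pi})" for x
      unfolding cis_conv_exp of_real_mult
      using assms
      by (intro has_vector_derivative_real_field) (auto intro!: derivative_eq_intros simp: field_simps)
  qed (auto intro!: continuous_intros)
  also have "cis (n * (2 * pi)) = 1" using cis_multiple_2pi[OF assms(1)] by (simp add: mult_ac)
  finally show ?thesis by simp
qed

text \<open>The integral factors over the coordinates, and a coordinate with nonzero frequency
  contributes an integral over full periods, which vanishes.\<close>

lemma integral_character:
  assumes "int_vec (k::real^2)" "k \<noteq> 0"
  shows "(LINT \<psi>|m0. cis (k \<bullet> \<psi>)) = 0"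
proof -
  obtain i where i: "k $ i \<noteq> 0" using assms(2) by (auto simp: vec_eq_iff)
  have "(LINT \<psi>|m0. cis (k \<bullet> \<psi>)) = (LINT \<psi>|m0. (\<Prod>i\<in>UNIV. cis (k $ i * \<psi> $ i)))"
    by (simp add: inner_vec_def UNIV_2 cis_mult)
  also have "\<dots> = (\<Prod>i\<in>UNIV. (LINT x|lborel. indicator {0..2*pi} x *\<^sub>R cis (k $ i * x)) / (2 * pi))"
    by (rule integral_m0_prod) (intro continuous_intros)
  also have "\<dots> = 0"
    using i assms(1) by (intro prod_zero) (auto simp: int_vec_def intro!: exI[of _ i] integral_cis_period)
  finally show ?thesis .
qed

section \<open>Finite orbits and eigenvalues on the unit circle\<close>

lemma periodic_point_imp_unit_eigenvalue:
  fixes M :: "complex^'n^'n"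
  assumes "((*v) M ^^ m) v = v" "v \<noteq> 0" "m > 0"
  obtains c w where "w \<noteq> 0" "M *v w = c *s w" "norm c = 1"
proof -
  \<comment> \<open>Discrete Fourier transform along the periodic orbit: \<open>u r\<close> is an eigenvector unless it vanishes,
    and the \<open>u r\<close> sum up to \<open>m v\<close>.\<close>
  define \<omega> where "\<omega> r = cis (2 * pi * real r / real m)" for r
  define u where "u r = (\<Sum>j<m. (inverse (\<omega> r) ^ j) *s ((*v) M ^^ j) v)" for r
  have \<omega>: "\<omega> r \<noteq> 0" "\<omega> r ^ m = 1" "norm (\<omega> r) = 1" for r
  proof -
    show "\<omega> r ^ m = 1"
      using assms(3) cis_multiple_2pi[of "real r"] unfolding \<omega>_def Complex.DeMoivre by (simp add: field_simps)
  qed (simp_all add: \<omega>_def)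
  have eig: "M *v u r = \<omega> r *s u r" for r
  proof -
    let ?a = "\<lambda>j. (inverse (\<omega> r) ^ j) *s ((*v) M ^^ j) v"
    have "M *v u r = (\<Sum>j<m. M *v ?a j)"
      unfolding u_def by (rule vec.linear_sum[OF matrix_vector_mul_linear_gen])
    also have "\<dots> = (\<Sum>j<m. \<omega> r *s ?a (Suc j))"
      using \<omega>(1) by (intro sum.cong) (auto simp: vec.scale vector_smult_assoc matrix_vector_mult_scaleR vector_scalar_commute)
    also have "\<dots> = \<omega> r *s (\<Sum>j<m. ?a (Suc j))" by (simp add: vec.scale_sum_right)
    \<comment> \<open>The terms are \<open>m\<close>-periodic in \<open>j\<close>, so shifting the
      index leaves the sum unchanged.\<close>
    also have "(\<Sum>j<m. ?a (Suc j)) = (\<Sum>j<m. ?a j) + ?a m - ?a 0"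
      using sum.lessThan_Suc_shift[of ?a m] by (simp add: sum.lessThan_Suc algebra_simps)
    also have "?a m = ?a 0" using assms(1) \<omega>(2)[of r] by (simp add: power_inverse)
    finally show ?thesis by (simp add: u_def)
  qed
  \<comment> \<open>Orthogonality of the roots of unity: the coefficient of the \<open>j\<close>-th
    orbit point is a geometric sum in \<open>r\<close>, which vanishes unless
    \<open>j = 0\<close>.\<close>
  have "(\<Sum>r<m. u r) = (\<Sum>j<m. (\<Sum>r<m. inverse (\<omega> r) ^ j) *s ((*v) M ^^ j) v)"
    unfolding u_def by (subst sum.swap) (simp add: vec.scale_sum_left)
  also have "\<dots> = (\<Sum>j<m. (if j = 0 then of_nat m else 0) *s ((*v) M ^^ j) v)"
  proof (intro sum.cong refl arg_cong2[where f = "(*s)"])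
    fix j assume j: "j \<in> {..<m}"
    define q where "q = cis (- (2 * pi * real j / real m))"
    have "inverse (\<omega> r) ^ j = q ^ r" for r
      unfolding \<omega>_def q_def cis_inverse Complex.DeMoivre by (simp add: field_simps)
    then have eq: "(\<Sum>r<m. inverse (\<omega> r) ^ j) = (\<Sum>r<m. q ^ r)" by simp
    have qm: "q ^ m = 1"
      using assms(3) cis_multiple_2pi[of "- real j"] unfolding q_def Complex.DeMoivre by (simp add: field_simps)
    show "(\<Sum>r<m. inverse (\<omega> r) ^ j) = (if j = 0 then of_nat m else 0)"
    proof (cases "j = 0")
      case True then show ?thesis by simp
    next
      case False
      have "q \<noteq> 1"
      proof
        assume "q = 1"
        then have "cos (2 * pi * real j / real m) = 1" by (simp add: q_def complex_eq_iff)
        then obtain n :: int where "2 * pi * real j / real m = real_of_int n * 2 * pi"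
          using cos_one_2pi_int by blast
        then have "real j = real_of_int n * real m" using assms(3) by (simp add: field_simps)
        then have "int j = n * int m" by (metis of_int_eq_iff of_int_mult of_int_of_nat_eq)
        then have "int m dvd int j" by simp
        then show False using False j by (auto dest: dvd_imp_le)
      qed
      then show ?thesis using False eq qm by (simp add: geometric_sum)
    qed
  qed
  also have "\<dots> = of_nat m *s v"
    using assms(3) by (simp add: if_distrib[of "\<lambda>c. c *s _"] cong: if_cong)
  finally have "(\<Sum>r<m. u r) \<noteq> 0" using assms by simp
  then obtain r where "u r \<noteq> 0" by (meson sum.neutral)
  with eig \<omega>(3) that show thesis by blast
qed

text \<open>\<open>M - mat c\<close> and its transpose are singular together, because left and right
  invertibility agree for square matrices.\<close>

lemma eigenvalue_transpose:
  fixes M :: "'a::field^'n^'n"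
  assumes "transpose M *v w = c *s w" "w \<noteq> 0"
  obtains v where "v \<noteq> 0" "M *v v = c *s v"
proof -
  have mat: "mat c *v x = c *s x" for x :: "'a^'n"
    by (simp add: vec_eq_iff mat_def matrix_vector_mult_def if_distrib[of "\<lambda>y. y * _"] cong: if_cong)
  define N where "N = M - mat c"
  have tN: "transpose N = transpose M - mat c"
    by (simp add: N_def transpose_def mat_def vec_eq_iff)
  have "transpose N *v w = 0"
    unfolding tN matrix_vector_mult_diff_rdistrib mat assms(1) by simp
  then have "\<nexists>B. B ** transpose N = mat 1"
    using assms(2) matrix_left_invertible_ker by blast
  then have "\<nexists>B. B ** N = mat 1"
    using left_invertible_transpose right_invertible_transpose matrix_left_right_inverse by metis
  then obtain v where "N *v v = 0" "v \<noteq> 0"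
    using matrix_left_invertible_ker by blast
  with that show thesis
    unfolding N_def matrix_vector_mult_diff_rdistrib mat by simp
qed

section \<open>Anosov automorphisms act freely on characters\<close>

text \<open>A nonzero periodic covector, complexified, is a periodic point of the transpose, which
  then has an eigenvalue of modulus 1. \<open>A\<close> shares that eigenvalue, contradicting
  hyperbolicity.\<close>

lemma anosov_no_periodic_covector:
  assumes "anosov_automorphism A" "((\<lambda>x. x v* A) ^^ m) k = k" "m > 0"
  shows "k = (0::real^2)"
proof (rule ccontr)
  assume "k \<noteq> 0"
  define M where "M = (\<chi> i j. complex_of_real (A $ i $ j))"
  define c where "c v = (\<chi> i. complex_of_real (v $ i))" for v :: "real^2"
  have step: "transpose M *v c v = c (v v* A)" for v
    by (simp add: M_def c_def vector_matrix_mult_def vec_eq_iff)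
  have "((*v) (transpose M) ^^ j) (c v) = c (((\<lambda>x. x v* A) ^^ j) v)" for j v
    by (induction j) (simp_all add: step del: transpose_matrix_vector)
  then have "((*v) (transpose M) ^^ m) (c k) = c k" by (simp only: assms(2))
  moreover have "c k \<noteq> 0" using \<open>k \<noteq> 0\<close> by (auto simp: c_def vec_eq_iff)
  ultimately obtain \<mu> w where w: "w \<noteq> 0" "transpose M *v w = \<mu> *s w" "norm \<mu> = 1"
    using periodic_point_imp_unit_eigenvalue assms(3) by metis
  obtain v where "v \<noteq> 0" "M *v v = \<mu> *s v"
    using eigenvalue_transpose[OF w(2,1)] .
  then show False
    using assms(1) w(3) unfolding anosov_automorphism_def M_def by blast
qed

text \<open>Cramer's rule: \<open>B\<close> is \<open>det A\<close> times the adjugate, and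
  \<open>det A\<close> is its own inverse, being 1 or -1.\<close>

lemma anosov_inverse:
  assumes "anosov_automorphism A"
  obtains B where "A ** B = mat 1" "B ** A = mat 1" "\<And>i j. B $ i $ j \<in> \<int>"
proof -
  define B :: "real^2^2" where
    "B = (\<chi> i j. det A * (if i = j then (if i = 1 then A $ 2 $ 2 else A $ 1 $ 1) else - A $ i $ j))"
  have A: "A $ i $ j \<in> \<int>" for i j using assms by (auto simp: anosov_automorphism_def)
  have "\<bar>det A\<bar> = 1" using assms by (auto simp: anosov_automorphism_def)
  then have d: "det A * det A = 1" by (auto simp: abs_if split: if_splits)
  have d': "det A * (A$1$1 * A$2$2 - A$1$2 * A$2$1) = 1" using d by (simp add: det_2)
  have "det A \<in> \<int>" using A by (auto simp: det_2 intro!: Ints_diff Ints_mult)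
  then have B: "B $ i $ j \<in> \<int>" for i j
    using A by (auto simp: B_def intro!: Ints_mult Ints_minus)
  have "A ** B = mat 1"
    using d' by (simp add: vec_eq_iff forall_2 matrix_matrix_mult_def sum_2 mat_def B_def algebra_simps)
  with B that matrix_left_right_inverse show thesis by blast
qed

text \<open>\<open>T' j\<close> is the adjoint action of \<open>T j\<close> on frequencies.
  Injectivity in \<open>j\<close> says that a nontrivial character pulled back along the family
  gives pairwise distinct characters, hence an orthogonal family in L2.\<close>

definition free_family :: "(nat \<Rightarrow> real^2 \<Rightarrow> real^2) \<Rightarrow> bool" where
  "free_family T \<longleftrightarrow> (\<forall>j. continuous_on UNIV (T j)) \<and>
     (\<exists>T'. (\<forall>j x y. x \<bullet> T j y = T' j x \<bullet> y) \<and> (\<forall>j k. int_vec k \<longrightarrow> int_vec (T' j k)) \<and>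
        (\<forall>k. int_vec k \<longrightarrow> k \<noteq> 0 \<longrightarrow> inj (\<lambda>j. T' j k)))"

lemma inner_funpow_matrix:
  fixes M :: "real^'n^'n"
  shows "x \<bullet> ((*v) M ^^ j) y = ((\<lambda>x. x v* M) ^^ j) x \<bullet> y"
proof (induction j arbitrary: x)
  case (Suc j)
  have "x \<bullet> ((*v) M ^^ Suc j) y = (x v* M) \<bullet> ((*v) M ^^ j) y"
    by (simp add: dot_lmul_matrix)
  also have "\<dots> = ((\<lambda>x. x v* M) ^^ Suc j) x \<bullet> y"
    unfolding Suc.IH by (simp only: funpow_Suc_right o_apply)
  finally show ?case .
qed simp

lemma int_vec_vector_matrix_mult:
  assumes "\<And>i j. M $ i $ j \<in> \<int>" "int_vec k"
  shows "int_vec (k v* M)"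
  using assms by (auto simp: int_vec_def vector_matrix_mult_def intro!: Ints_sum Ints_mult)

lemma funpow_cancel:
  fixes f g :: "'a \<Rightarrow> 'a"
  assumes "\<And>x. f (g x) = x"
  shows "(f ^^ n) ((g ^^ n) x) = x"
proof (induction n arbitrary: x)
  case (Suc n)
  have "(f ^^ Suc n) ((g ^^ Suc n) x) = (f ^^ n) (f (g ((g ^^ n) x)))"
    by (simp add: funpow_swap1)
  then show ?case using Suc assms by simp
qed simp

text \<open>If two indices gave the same frequency, cancelling the inverse powers would leave a
  periodic covector. The \<open>N\<close> backward steps change nothing, since \<open>?B\<close> is
  injective on frequencies; they serve orbits that start in the past.\<close>

lemma anosov_free_family:
  assumes "anosov_automorphism A" "A ** B = mat 1" "\<And>i j. B $ i $ j \<in> \<int>"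
  shows "free_family (\<lambda>j \<psi>. ((*v) A ^^ j) (((*v) B ^^ N) \<psi>))"
proof -
  let ?A = "\<lambda>x::real^2. x v* A" and ?B = "\<lambda>x::real^2. x v* B"
  have A: "A $ i $ j \<in> \<int>" for i j using assms(1) by (auto simp: anosov_automorphism_def)
  have AB: "?A (?B x) = x" for x
    using assms(2)[unfolded matrix_left_right_inverse[of A]] by (simp add: vector_matrix_mul_assoc)
  have BA: "?B (?A x) = x" for x
    using assms(2) by (simp add: vector_matrix_mul_assoc)
  have intp: "int_vec ((?A ^^ j) k)" "int_vec ((?B ^^ j) k)" if "int_vec k" for j k
    by (induction j) (auto simp: that intro!: int_vec_vector_matrix_mult A assms(3))
  have inner: "x \<bullet> ((*v) A ^^ j) (((*v) B ^^ N) y) = (?B ^^ N) ((?A ^^ j) x) \<bullet> y" for x y j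
    by (simp add: inner_funpow_matrix)
  have neq: "(?A ^^ i) k \<noteq> (?A ^^ j) k" if "i < j" "k \<noteq> 0" for i j k
  proof
    assume eq: "(?A ^^ i) k = (?A ^^ j) k"
    have "k = (?B ^^ i) ((?A ^^ i) k)" by (simp add: funpow_cancel BA)
    also have "\<dots> = (?B ^^ i) ((?A ^^ i) ((?A ^^ (j - i)) k))"
      using \<open>i < j\<close> by (simp add: eq flip: funpow_add[unfolded o_def fun_eq_iff, rule_format])
    also have "\<dots> = (?A ^^ (j - i)) k" by (simp add: funpow_cancel BA)
    finally have "(?A ^^ (j - i)) k = k" by (rule sym)
    then show False using anosov_no_periodic_covector[OF assms(1)] that by auto
  qed
  have "inj (\<lambda>j. (?B ^^ N) ((?A ^^ j) k))" if "k \<noteq> 0" for k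
  proof (rule injI)
    fix i j assume "(?B ^^ N) ((?A ^^ i) k) = (?B ^^ N) ((?A ^^ j) k)"
    then have "(?A ^^ N) ((?B ^^ N) ((?A ^^ i) k)) = (?A ^^ N) ((?B ^^ N) ((?A ^^ j) k))"
      by (rule arg_cong)
    then have "(?A ^^ i) k = (?A ^^ j) k" by (simp only: funpow_cancel[where f = ?A and g = ?B, OF AB])
    then show "i = j" using neq[OF _ that] by (metis linorder_neqE_nat)
  qed
  moreover have c: "continuous_on UNIV ((*v) M ^^ j)" for j and M :: "real^2^2"
  proof (induction j)
    case (Suc j)
    show ?case
      unfolding funpow.simps(2)
      by (intro continuous_on_compose Suc matrix_vector_mult_linear_continuous_on)
  qed (simp add: id_def)
  have "continuous_on UNIV (\<lambda>\<psi>. ((*v) A ^^ j) (((*v) B ^^ N) \<psi>))" for j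
    by (rule continuous_on_compose2[OF c c]) simp
  ultimately show ?thesis
    unfolding free_family_def using inner intp
    by (intro conjI exI[of _ "\<lambda>j k. (?B ^^ N) ((?A ^^ j) k)"]) auto
qed

section \<open>Bounded continuous functions\<close>

text \<open>An algebra of functions integrable with respect to the finite measure \<open>m0\<close>,
  so that integrability conditions reduce to introduction rules.\<close>

definition bdd_continuous :: "(real^2 \<Rightarrow> 'a::real_normed_vector) \<Rightarrow> bool" where
  "bdd_continuous h \<longleftrightarrow> continuous_on UNIV h \<and> bounded (range h)"

named_theorems bdd_continuous_intros

lemma bdd_continuous_const [bdd_continuous_intros]: "bdd_continuous (\<lambda>\<psi>. c)"
  by (auto simp: bdd_continuous_def)

lemma bdd_continuous_cis [bdd_continuous_intros]: "bdd_continuous (\<lambda>\<psi>. cis (k \<bullet> \<psi>))"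
  by (auto simp: bdd_continuous_def bounded_iff intro!: continuous_intros exI[of _ 1])

lemma bdd_continuous_add [bdd_continuous_intros]:
  "bdd_continuous g \<Longrightarrow> bdd_continuous h \<Longrightarrow> bdd_continuous (\<lambda>\<psi>. g \<psi> + h \<psi>)"
  by (auto simp: bdd_continuous_def intro!: continuous_intros bounded_plus_comp)

lemma bdd_continuous_diff [bdd_continuous_intros]:
  "bdd_continuous g \<Longrightarrow> bdd_continuous h \<Longrightarrow> bdd_continuous (\<lambda>\<psi>. g \<psi> - h \<psi>)"
  by (auto simp: bdd_continuous_def intro!: continuous_intros bounded_minus_comp)

lemma bdd_continuous_mult [bdd_continuous_intros]:
  fixes g h :: "real^2 \<Rightarrow> 'a::real_normed_algebra"
  assumes "bdd_continuous g" "bdd_continuous h"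
  shows "bdd_continuous (\<lambda>\<psi>. g \<psi> * h \<psi>)"
proof -
  obtain a b where ab: "\<And>\<psi>. norm (g \<psi>) \<le> a" "\<And>\<psi>. norm (h \<psi>) \<le> b"
    using assms by (auto simp: bdd_continuous_def bounded_iff)
  have "norm (g \<psi> * h \<psi>) \<le> a * b" for \<psi>
    using norm_mult_ineq[of "g \<psi>" "h \<psi>"] mult_mono[OF ab(1)[of \<psi>] ab(2)[of \<psi>]] ab[of \<psi>]
      norm_ge_zero[of "g \<psi>"] norm_ge_zero[of "h \<psi>"] by linarith
  then show ?thesis
    using assms by (auto simp: bdd_continuous_def bounded_iff intro!: continuous_intros)
qed

lemma bdd_continuous_norm [bdd_continuous_intros]:
  "bdd_continuous g \<Longrightarrow> bdd_continuous (\<lambda>\<psi>. norm (g \<psi>))"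
  by (auto simp: bdd_continuous_def bounded_iff intro!: continuous_intros)

lemma bdd_continuous_power2 [bdd_continuous_intros]:
  fixes g :: "real^2 \<Rightarrow> 'a::real_normed_algebra_1"
  shows "bdd_continuous g \<Longrightarrow> bdd_continuous (\<lambda>\<psi>. (g \<psi>)\<^sup>2)"
  unfolding power2_eq_square by (intro bdd_continuous_intros)

lemma bdd_continuous_sum [bdd_continuous_intros]:
  "(\<And>i. i \<in> I \<Longrightarrow> bdd_continuous (g i)) \<Longrightarrow> bdd_continuous (\<lambda>\<psi>. \<Sum>i\<in>I. g i \<psi>)"
  by (induction I rule: infinite_finite_induct) (auto intro!: bdd_continuous_intros)

lemma bdd_continuous_compose:
  "bdd_continuous h \<Longrightarrow> continuous_on UNIV T \<Longrightarrow> bdd_continuous (\<lambda>\<psi>. h (T \<psi>))"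
  unfolding bdd_continuous_def
  by (auto intro: continuous_on_compose2 bounded_subset)

lemma integrable_bdd_continuous:
  fixes h :: "real^2 \<Rightarrow> 'a::{banach, second_countable_topology}"
  assumes "bdd_continuous h"
  shows "integrable m0 h"
proof -
  obtain b where b: "\<And>\<psi>. norm (h \<psi>) \<le> b"
    using assms by (auto simp: bdd_continuous_def bounded_iff)
  have "h \<in> borel_measurable borel"
    using assms by (auto simp: bdd_continuous_def intro: borel_measurable_continuous_onI)
  then show ?thesis
    by (intro m0.integrable_const_bound[where B = b]) (auto simp: b cong: measurable_cong_sets)
qed

section \<open>Second moments of trigonometric sums\<close>

text \<open>Parseval: the squared modulus expands into a double sum of characters with frequencies
  \<open>T' i k - T' j k\<close>, which are nonzero off the diagonal and integrate to 0
  there.\<close>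

lemma character_sum_second_moment:
  assumes "free_family T" "int_vec k" "k \<noteq> 0"
  shows "(LINT \<psi>|m0. (cmod (\<Sum>j<n. a j * cis (k \<bullet> T j \<psi>)))\<^sup>2) = (\<Sum>j<n. (cmod (a j))\<^sup>2)"
proof -
  obtain T' where T': "\<And>j x y. x \<bullet> T j y = T' j x \<bullet> y" "\<And>j k. int_vec k \<Longrightarrow> int_vec (T' j k)"
     "inj (\<lambda>j. T' j k)"
    using assms unfolding free_family_def by metis
  have "complex_of_real ((cmod (\<Sum>j<n. a j * cis (k \<bullet> T j \<psi>)))\<^sup>2)
      = (\<Sum>i<n. \<Sum>j<n. (a i * cnj (a j)) * cis ((T' i k - T' j k) \<bullet> \<psi>))" for \<psi>
    unfolding complex_norm_square cnj_sum sum_product T'(1)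
  proof (intro sum.cong refl)
    fix i j
    have "cis ((T' i k - T' j k) \<bullet> \<psi>) = cis (T' i k \<bullet> \<psi>) * cnj (cis (T' j k \<bullet> \<psi>))"
      unfolding cis_cnj cis_inverse cis_mult by (simp add: inner_diff_left)
    then show "a i * cis (T' i k \<bullet> \<psi>) * cnj (a j * cis (T' j k \<bullet> \<psi>))
        = (a i * cnj (a j)) * cis ((T' i k - T' j k) \<bullet> \<psi>)"
      by (simp only: complex_cnj_mult mult_ac)
  qed
  then have "complex_of_real (LINT \<psi>|m0. (cmod (\<Sum>j<n. a j * cis (k \<bullet> T j \<psi>)))\<^sup>2)
      = (LINT \<psi>|m0. (\<Sum>i<n. \<Sum>j<n. (a i * cnj (a j)) * cis ((T' i k - T' j k) \<bullet> \<psi>)))"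
    by (simp only: integral_complex_of_real[symmetric])
  also have "\<dots> = (\<Sum>i<n. \<Sum>j<n. (a i * cnj (a j)) * (LINT \<psi>|m0. cis ((T' i k - T' j k) \<bullet> \<psi>)))"
    by (subst Bochner_Integration.integral_sum,
        intro integrable_bdd_continuous bdd_continuous_intros,
        intro sum.cong refl, subst Bochner_Integration.integral_sum,
        intro integrable_bdd_continuous bdd_continuous_intros, simp)
  also have "\<dots> = (\<Sum>i<n. \<Sum>j<n. if i = j then a i * cnj (a j) else 0)"
  proof (intro sum.cong refl)
    fix i j
    have "int_vec (T' i k - T' j k)"
      using T'(2)[OF assms(2)] by (auto simp: int_vec_def)
    moreover have "i \<noteq> j \<Longrightarrow> T' i k - T' j k \<noteq> 0"
      using T'(3) by (auto dest: injD)
    ultimately show "(a i * cnj (a j)) * (LINT \<psi>|m0. cis ((T' i k - T' j k) \<bullet> \<psi>)) = (if i = j then a i * cnj (a j) else 0)"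
      by (auto simp: integral_character)
  qed
  also have "\<dots> = (\<Sum>i<n. a i * cnj (a i))" by simp
  also have "\<dots> = complex_of_real (\<Sum>i<n. (cmod (a i))\<^sup>2)"
    by (simp only: of_real_sum complex_norm_square)
  finally show ?thesis by (simp only: of_real_eq_iff)
qed

text \<open>Trigonometric polynomials in \<psi> whose coefficients depend continuously on the slow
  variable \<open>z\<close>; on compact \<open>z\<close>-intervals the coefficients are therefore
  bounded.\<close>

inductive trig_poly :: "(real \<Rightarrow> real^2 \<Rightarrow> complex) \<Rightarrow> bool" where
  character: "continuous_on UNIV a \<Longrightarrow> int_vec k \<Longrightarrow> trig_poly (\<lambda>z \<psi>. a z * cis (k \<bullet> \<psi>))"
| add: "trig_poly g \<Longrightarrow> trig_poly h \<Longrightarrow> trig_poly (\<lambda>z \<psi>. g z \<psi> + h z \<psi>)"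

lemma trig_poly_mult:
  assumes "trig_poly g" "trig_poly h"
  shows "trig_poly (\<lambda>z \<psi>. g z \<psi> * h z \<psi>)"
  using assms(1)
proof induction
  case (character a k)
  show ?case using assms(2)
  proof induction
    case (character b l)
    have "trig_poly (\<lambda>z \<psi>. (a z * b z) * cis ((k + l) \<bullet> \<psi>))"
      using \<open>continuous_on UNIV a\<close> \<open>int_vec k\<close> character
      by (intro trig_poly.character) (auto simp: int_vec_def intro!: continuous_intros)
    then show ?case by (simp add: inner_add_left mult_ac flip: cis_mult)
  next
    case (add g h)
    then show ?case unfolding distrib_left by (intro trig_poly.add)
  qed
next
  case (add g h)
  then show ?case unfolding distrib_right by (intro trig_poly.add)
qed

lemma trig_poly_bdd_continuous: "trig_poly g \<Longrightarrow> bdd_continuous (g z)"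
  by (induction rule: trig_poly.induct) (auto intro!: bdd_continuous_intros)

text \<open>Centring removes the zero frequency, and the other characters are covered by
  \<open>character_sum_second_moment\<close> with coefficients bounded on the interval of radius
  \<open>R\<close>. The constant depends on \<open>g\<close> and \<open>R\<close> only, not on the
  family, the points \<open>z j\<close> or \<open>n\<close>.\<close>

lemma trig_poly_second_moment:
  assumes "trig_poly g"
  shows "\<exists>C. \<forall>T z n. free_family T \<longrightarrow> (\<forall>j<n. \<bar>z j\<bar> \<le> R) \<longrightarrow>
     (LINT \<psi>|m0. (cmod (\<Sum>j<n. g (z j) (T j \<psi>) - (LINT \<theta>|m0. g (z j) \<theta>)))\<^sup>2) \<le> C * real n"
  using assms
proof induction
  case (character a k)
  show ?case
  proof (cases "k = 0")
    case True
    then show ?thesis by (intro exI[of _ 0]) simp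
  next
    case False
    have "compact (a ` {-R..R})"
      by (rule compact_continuous_image[OF continuous_on_subset[OF character(1)]]) auto
    then obtain b where b: "\<And>z. \<bar>z\<bar> \<le> R \<Longrightarrow> cmod (a z) \<le> b"
      by (force dest!: compact_imp_bounded simp: bounded_iff abs_le_iff)
    have "(\<Sum>j<n. (cmod (a (z j)))\<^sup>2) \<le> b\<^sup>2 * real n" if "\<forall>j<n. \<bar>z j\<bar> \<le> R" for z n
      using sum_mono[of "{..<n}" "\<lambda>j. (cmod (a (z j)))\<^sup>2" "\<lambda>_. b\<^sup>2"] b that
      by (simp add: power_mono mult.commute)
    then show ?thesis
      using False character(2)
      by (intro exI[of _ "b\<^sup>2"]) (simp add: integral_character character_sum_second_moment)
  qed
next
  case (add g h)
  obtain C where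
    C: "\<forall>T z n. free_family T \<longrightarrow> (\<forall>j<n. \<bar>z j\<bar> \<le> R) \<longrightarrow>
     (LINT \<psi>|m0. (cmod (\<Sum>j<n. g (z j) (T j \<psi>) - (LINT \<theta>|m0. g (z j) \<theta>)))\<^sup>2) \<le> C * real n"
    using add.IH(1) by (rule exE)
  obtain D where
    D: "\<forall>T z n. free_family T \<longrightarrow> (\<forall>j<n. \<bar>z j\<bar> \<le> R) \<longrightarrow>
     (LINT \<psi>|m0. (cmod (\<Sum>j<n. h (z j) (T j \<psi>) - (LINT \<theta>|m0. h (z j) \<theta>)))\<^sup>2) \<le> D * real n"
    using add.IH(2) by (rule exE)
  have "(LINT \<psi>|m0. (cmod (\<Sum>j<n. (g (z j) (T j \<psi>) + h (z j) (T j \<psi>))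
          - (LINT \<theta>|m0. g (z j) \<theta> + h (z j) \<theta>)))\<^sup>2) \<le> (2 * C + 2 * D) * real n"
    if T: "free_family T" and z: "\<forall>j<n. \<bar>z j\<bar> \<le> R" for T z n
  proof -
    define G where "G \<psi> = (\<Sum>j<n. g (z j) (T j \<psi>) - (LINT \<theta>|m0. g (z j) \<theta>))" for \<psi>
    define H where "H \<psi> = (\<Sum>j<n. h (z j) (T j \<psi>) - (LINT \<theta>|m0. h (z j) \<theta>))" for \<psi>
    have cT: "continuous_on UNIV (T j)" for j using T by (auto simp: free_family_def)
    have bc: "bdd_continuous G" "bdd_continuous H"
      unfolding G_def H_def
      by (intro bdd_continuous_intros bdd_continuous_compose[OF _ cT]
          trig_poly_bdd_continuous add.hyps)+
    have "(LINT \<psi>|m0. (cmod (G \<psi> + H \<psi>))\<^sup>2) \<le> (LINT \<psi>|m0. 2 * (cmod (G \<psi>))\<^sup>2 + 2 * (cmod (H \<psi>))\<^sup>2)"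
    proof (intro integral_mono integrable_bdd_continuous bdd_continuous_intros bc)
      fix \<psi>
      have "(cmod (G \<psi> + H \<psi>))\<^sup>2 \<le> (cmod (G \<psi>) + cmod (H \<psi>))\<^sup>2"
        by (intro power_mono norm_triangle_ineq) auto
      also have "\<dots> \<le> 2 * (cmod (G \<psi>))\<^sup>2 + 2 * (cmod (H \<psi>))\<^sup>2"
        using sum_squares_bound[of "cmod (G \<psi>)" "cmod (H \<psi>)"] by (simp add: power2_sum)
      finally show "(cmod (G \<psi> + H \<psi>))\<^sup>2 \<le> 2 * (cmod (G \<psi>))\<^sup>2 + 2 * (cmod (H \<psi>))\<^sup>2" .
    qed
    also have "\<dots> = 2 * (LINT \<psi>|m0. (cmod (G \<psi>))\<^sup>2) + 2 * (LINT \<psi>|m0. (cmod (H \<psi>))\<^sup>2)"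
      by (subst Bochner_Integration.integral_add)
         (auto intro!: integrable_bdd_continuous bdd_continuous_intros bc)
    also have "\<dots> \<le> 2 * (C * n) + 2 * (D * n)"
      using C[THEN spec, THEN spec, THEN spec, THEN mp, OF T, THEN mp, OF z]
        D[THEN spec, THEN spec, THEN spec, THEN mp, OF T, THEN mp, OF z]
      unfolding G_def H_def by linarith
    also have "(LINT \<psi>|m0. (cmod (G \<psi> + H \<psi>))\<^sup>2) = (LINT \<psi>|m0. (cmod (\<Sum>j<n. (g (z j) (T j \<psi>) + h (z j) (T j \<psi>))
          - (LINT \<theta>|m0. g (z j) \<theta> + h (z j) \<theta>)))\<^sup>2)"
      unfolding G_def H_def
      by (subst Bochner_Integration.integral_add)
         (auto intro!: integrable_bdd_continuous trig_poly_bdd_continuous add.hyps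
           simp: sum.distrib[symmetric] algebra_simps)
    finally show ?thesis by (simp add: algebra_simps)
  qed
  then show ?case by blast
qed

section \<open>Approximation and the maximal weak law\<close>

lemma trig_poly_const: "continuous_on UNIV a \<Longrightarrow> trig_poly (\<lambda>z \<psi>. a z)"
  using trig_poly.character[of a 0] by (simp add: int_vec_def)

lemma trig_poly_cis: "trig_poly (\<lambda>z \<psi>. c * cis (\<psi> $ i))" "trig_poly (\<lambda>z \<psi>. c * cis (- \<psi> $ i))"
proof -
  have "int_vec (axis i 1 :: real^2)" "int_vec (- axis i 1 :: real^2)"
    by (auto simp: int_vec_def axis_def)
  from this[THEN trig_poly.character[where a = "\<lambda>_. c", OF continuous_on_const]]
  show "trig_poly (\<lambda>z \<psi>. c * cis (\<psi> $ i))" "trig_poly (\<lambda>z \<psi>. c * cis (- \<psi> $ i))"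
    by (simp_all add: inner_axis')
qed

lemma trig_poly_cos: "trig_poly (\<lambda>z \<psi>. complex_of_real (cos (\<psi> $ i) * c))"
proof -
  have "complex_of_real (cos x * c) = of_real (c / 2) * cis x + of_real (c / 2) * cis (- x)" for x
    by (simp add: complex_eq_iff)
  then show ?thesis by (simp only:) (intro trig_poly.add trig_poly_cis)
qed

lemma trig_poly_sin: "trig_poly (\<lambda>z \<psi>. complex_of_real (sin (\<psi> $ i) * c))"
proof -
  have "complex_of_real (sin x * c) = (- \<i> * of_real (c / 2)) * cis x + (\<i> * of_real (c / 2)) * cis (- x)" for x
    by (simp add: complex_eq_iff)
  then show ?thesis by (simp only:) (intro trig_poly.add trig_poly_cis)
qed

text \<open>The arguments of \<open>p\<close> are the coordinates of an embedding of the torus, so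
  this makes polynomial approximation on the embedded torus an approximation by trigonometric
  polynomials.\<close>

lemma trig_poly_real_polynomial:
  assumes "real_polynomial_function p"
  shows "trig_poly (\<lambda>z \<psi>. complex_of_real (p (z, cis (\<psi> $ 1), cis (\<psi> $ 2))))"
  using assms
proof induction
  case (linear l)
  interpret bounded_linear l by fact
  \<comment> \<open>A real-linear functional is determined by its values on the five real coordinate
    vectors; the coordinates are \<open>z\<close> and the cosines and sines of both angles.\<close>
  have "l (z, cis x, cis y) = z * l (1, 0, 0) + cos x * l (0, 1, 0) + sin x * l (0, \<i>, 0)
      + cos y * l (0, 0, 1) + sin y * l (0, 0, \<i>)" for z x y
  proof -
    have "(z, cis x, cis y) = z *\<^sub>R (1, 0, 0) + cos x *\<^sub>R (0, 1, 0) + sin x *\<^sub>R (0, \<i>, 0)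
      + cos y *\<^sub>R (0, 0, 1) + sin y *\<^sub>R (0, 0, \<i>)"
      by (simp add: complex_eq_iff)
    then show ?thesis by (simp only: add scaleR real_scaleR_def)
  qed
  moreover have "trig_poly (\<lambda>z \<psi>. complex_of_real (z * c))" for c
    by (intro trig_poly_const continuous_intros)
  ultimately show ?case
    by (simp only: of_real_add) (intro trig_poly.add trig_poly_cos trig_poly_sin; simp only: of_real_add)
next
  case (const c)
  then show ?case by (intro trig_poly_const continuous_intros)
next
  case (add f g)
  then show ?case by (simp only: of_real_add) (rule trig_poly.add)
next
  case (mult f g)
  then show ?case by (simp only: of_real_mult) (rule trig_poly_mult)
qed

section \<open>Functions on the torus and their uniform approximation\<close>

lemma torus_fun_eqI:
  assumes "torus_fun g" "\<And>i. cis (\<psi> $ i) = cis (\<psi>' $ i)"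
  shows "g \<psi> = g \<psi>'"
proof -
  have "\<exists>n::int. \<psi> $ i = \<psi>' $ i + 2 * pi * n" for i
    using assms(2)[of i] by (simp add: complex_eq_iff flip: sin_cos_eq_iff)
  then have "\<psi> - \<psi>' \<in> torus_lattice" by (simp add: torus_lattice_def) (metis add_diff_cancel_left')
  then have "g (\<psi>' + (\<psi> - \<psi>')) = g \<psi>'" using assms(1) by (simp only: torus_fun_def)
  then show ?thesis by simp
qed

text \<open>Closed, unlike the domain carrying \<open>m0\<close>, to be compact; points on opposite
  faces represent the same torus point.\<close>

definition torus_box :: "(real^2) set" where
  "torus_box = cbox 0 (\<chi> i. 2 * pi)"

lemma torus_box_representative:
  obtains \<psi>' where "\<psi>' \<in> torus_box" "\<And>i. cis (\<psi>' $ i) = cis (\<psi> $ i)"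
proof
  define \<psi>' where "\<psi>' = (\<chi> i. 2 * pi * frac (\<psi> $ i / (2 * pi)))"
  have "\<psi>' $ i = \<psi> $ i + 2 * pi * of_int (- \<lfloor>\<psi> $ i / (2 * pi)\<rfloor>)" for i
    by (simp add: \<psi>'_def frac_def field_simps)
  then show "cis (\<psi>' $ i) = cis (\<psi> $ i)" for i
    by (metis complex_eq_iff cis.sel sin_cos_eq_iff)
  show "\<psi>' \<in> torus_box"
    by (auto simp: \<psi>'_def torus_box_def mem_box_cart intro: less_imp_le[OF frac_lt_1])
qed

lemma torus_trig_approx:
  fixes f :: "real \<Rightarrow> real^2 \<Rightarrow> real"
  assumes cont: "continuous_on ({-R..R} \<times> UNIV) (\<lambda>(z, \<psi>). f z \<psi>)"
    and per: "\<And>z. torus_fun (f z)" and "e > 0"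
  obtains p :: "real \<Rightarrow> real^2 \<Rightarrow> real"
  where "trig_poly (\<lambda>z \<psi>. complex_of_real (p z \<psi>))" "\<And>z \<psi>. \<bar>z\<bar> \<le> R \<Longrightarrow> \<bar>f z \<psi> - p z \<psi>\<bar> < e"
proof -
  \<comment> \<open>\<open>f\<close> factors through the embedding \<open>E\<close> of the torus; the factor \<open>F\<close> is continuous because \<open>E\<close>
    is a closed map on the compact set \<open>D\<close>.\<close>
  define D :: "(real \<times> (real^2)) set" where "D = {-R..R} \<times> torus_box"
  define E :: "real \<times> (real^2) \<Rightarrow> real \<times> complex \<times> complex"
    where "E = (\<lambda>(z, \<psi>). (z, cis (\<psi> $ 1), cis (\<psi> $ 2)))"
  define F where "F y = (case inv_into D E y of (z, \<psi>) \<Rightarrow> f z \<psi>)" for y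
  have "compact D" unfolding D_def torus_box_def by (intro compact_Times) auto
  have contD: "continuous_on D (\<lambda>(z, \<psi>). f z \<psi>)"
    by (rule continuous_on_subset[OF cont]) (auto simp: D_def)
  have contE: "continuous_on S E" for S
    unfolding E_def case_prod_unfold by (intro continuous_intros)
  have FE: "F (E (z, \<psi>)) = f z \<psi>" if "(z, \<psi>) \<in> D" for z \<psi>
  proof -
    obtain z' \<psi>' where eq: "inv_into D E (E (z, \<psi>)) = (z', \<psi>')" by fastforce
    then have "E (z', \<psi>') = E (z, \<psi>)" using that by (metis f_inv_into_f imageI)
    then have "z' = z" "cis (\<psi>' $ i) = cis (\<psi> $ i)" for i
      using exhaust_2[of i] by (auto simp: E_def)
    then have "f z' \<psi>' = f z \<psi>" by (metis torus_fun_eqI per)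
    then show ?thesis by (simp add: F_def eq)
  qed
  have "continuous_on (E ` D) F"
    unfolding continuous_on_closed_invariant
  proof (intro allI impI)
    fix B :: "real set" assume "closed B"
    let ?P = "D \<inter> (\<lambda>(z, \<psi>). f z \<psi>) -` B"
    have "closed ?P"
      using continuous_closed_preimage[OF contD compact_imp_closed[OF \<open>compact D\<close>] \<open>closed B\<close>] .
    then have "compact (D \<inter> ?P)" by (rule compact_Int_closed[OF \<open>compact D\<close>])
    then have "closed (E ` (D \<inter> ?P))" by (intro compact_imp_closed compact_continuous_image contE)
    moreover have "E ` (D \<inter> ?P) \<inter> E ` D = F -` B \<inter> E ` D"
      using FE by (auto simp: image_iff)
    ultimately show "\<exists>A. closed A \<and> A \<inter> E ` D = F -` B \<inter> E ` D" by blast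
  qed
  then obtain q where q: "real_polynomial_function q" "\<And>y. y \<in> E ` D \<Longrightarrow> \<bar>F y - q y\<bar> < e"
    using Stone_Weierstrass_real_polynomial_function[of "E ` D" F e] \<open>e > 0\<close>
      compact_continuous_image[OF contE \<open>compact D\<close>] by blast
  have "\<bar>f z \<psi> - q (E (z, \<psi>))\<bar> < e" if "\<bar>z\<bar> \<le> R" for z \<psi>
  proof -
    obtain \<psi>' where \<psi>': "\<psi>' \<in> torus_box" "\<And>i. cis (\<psi>' $ i) = cis (\<psi> $ i)"
      using torus_box_representative[of \<psi>] by blast
    have D: "(z, \<psi>') \<in> D" and E: "E (z, \<psi>') = E (z, \<psi>)"
      using that \<psi>' by (auto simp: D_def E_def)
    have f: "f z \<psi>' = f z \<psi>" by (rule torus_fun_eqI[OF per \<psi>'(2)])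
    show ?thesis using q(2)[OF imageI[OF D]] FE[OF D] E f by simp
  qed
  moreover have "trig_poly (\<lambda>z \<psi>. complex_of_real (q (E (z, \<psi>))))"
    using trig_poly_real_polynomial[OF q(1)] by (simp add: E_def)
  ultimately show thesis by (intro that[of "\<lambda>z \<psi>. q (E (z, \<psi>))"])
qed

lemma bdd_continuous_of_real_iff:
  "bdd_continuous (\<lambda>\<psi>. complex_of_real (g \<psi>)) \<longleftrightarrow> bdd_continuous g"
  by (simp add: bdd_continuous_def bounded_iff continuous_on_of_real_o_iff)

text \<open>Boundedness over the whole plane is inherited from a trigonometric polynomial within
  distance 1.\<close>

lemma torus_bdd_continuous:
  fixes f :: "real \<Rightarrow> real^2 \<Rightarrow> real"
  assumes cont: "continuous_on ({-R..R} \<times> UNIV) (\<lambda>(z, \<psi>). f z \<psi>)"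
    and per: "\<And>z. torus_fun (f z)" and "\<bar>z\<bar> \<le> R"
  shows "bdd_continuous (f z)"
proof -
  obtain p where p: "trig_poly (\<lambda>z \<psi>. complex_of_real (p z \<psi>))" "\<And>z \<psi>. \<bar>z\<bar> \<le> R \<Longrightarrow> \<bar>f z \<psi> - p z \<psi>\<bar> < 1"
    using torus_trig_approx[OF cont per, of 1] by auto
  obtain b where b: "\<And>\<psi>. \<bar>p z \<psi>\<bar> \<le> b"
    using trig_poly_bdd_continuous[OF p(1), of z, unfolded bdd_continuous_of_real_iff]
    by (auto simp: bdd_continuous_def bounded_iff)
  have "\<bar>f z \<psi>\<bar> \<le> b + 1" for \<psi> using b[of \<psi>] p(2)[OF assms(3), of \<psi>] by linarith
  moreover have "continuous_on UNIV (\<lambda>\<psi>. case (z, \<psi>) of (z, \<psi>) \<Rightarrow> f z \<psi>)"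
    by (rule continuous_on_compose2[OF cont]) (use assms(3) in \<open>auto intro!: continuous_intros\<close>)
  ultimately show ?thesis by (auto simp: bdd_continuous_def bounded_iff)
qed

text \<open>Replacing \<open>f\<close> by a trigonometric polynomial costs a small multiple of
  \<open>n\<close> in the sum, hence a small multiple of the square of \<open>n\<close> in the
  second moment; the polynomial itself contributes only \<open>O(n)\<close>.\<close>

lemma centred_sum_second_moment:
  fixes f :: "real \<Rightarrow> real^2 \<Rightarrow> real"
  assumes cont: "continuous_on ({-R..R} \<times> UNIV) (\<lambda>(z, \<psi>). f z \<psi>)"
    and per: "\<And>z. torus_fun (f z)" and "e > 0"
  shows "\<exists>C. \<forall>T z n. free_family T \<longrightarrow> (\<forall>j<n. \<bar>z j\<bar> \<le> R) \<longrightarrow>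
     (LINT \<psi>|m0. (\<Sum>j<n. f (z j) (T j \<psi>) - avg f (z j))\<^sup>2) \<le> e * (real n)\<^sup>2 + C * real n"
proof -
  \<comment> \<open>Each summand changes by at most \<open>2 * e'\<close>, one \<open>e'\<close>
    from the value and one from the average. The choice makes twice the square of
    \<open>2 * e'\<close> equal to \<open>e\<close>.\<close>
  define e' where "e' = sqrt (e / 8)"
  have e': "e' > 0" "2 * (2 * e')\<^sup>2 = e" using \<open>e > 0\<close> by (auto simp: e'_def power_mult_distrib)
  obtain p where p: "trig_poly (\<lambda>z \<psi>. complex_of_real (p z \<psi>))" "\<And>z \<psi>. \<bar>z\<bar> \<le> R \<Longrightarrow> \<bar>f z \<psi> - p z \<psi>\<bar> < e'"
    using torus_trig_approx[OF cont per e'(1)] by auto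
  have pc: "bdd_continuous (p z)" for z
    using trig_poly_bdd_continuous[OF p(1)] bdd_continuous_of_real_iff by blast
  have fc: "bdd_continuous (f z)" if "\<bar>z\<bar> \<le> R" for z
    using torus_bdd_continuous[OF cont per that] .
  obtain C where C: "\<forall>T z n. free_family T \<longrightarrow> (\<forall>j<n. \<bar>z j\<bar> \<le> R) \<longrightarrow>
     (LINT \<psi>|m0. (cmod (\<Sum>j<n. complex_of_real (p (z j) (T j \<psi>)) - (LINT \<theta>|m0. complex_of_real (p (z j) \<theta>))))\<^sup>2) \<le> C * real n"
    using trig_poly_second_moment[OF p(1)] by (rule exE)
  have "(LINT \<psi>|m0. (\<Sum>j<n. f (z j) (T j \<psi>) - avg f (z j))\<^sup>2) \<le> e * (real n)\<^sup>2 + (2 * C) * real n"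
    if T: "free_family T" and z: "\<forall>j<n. \<bar>z j\<bar> \<le> R" for T z n
  proof -
    define P where "P \<psi> = (\<Sum>j<n. p (z j) (T j \<psi>) - avg p (z j))" for \<psi>
    define Y where "Y \<psi> = (\<Sum>j<n. f (z j) (T j \<psi>) - avg f (z j))" for \<psi>
    have cT: "continuous_on UNIV (T j)" for j using T by (auto simp: free_family_def)
    have bP: "bdd_continuous P" unfolding P_def
      by (intro bdd_continuous_intros bdd_continuous_compose[OF pc cT])
    have bY: "bdd_continuous Y" unfolding Y_def
      using z by (intro bdd_continuous_intros bdd_continuous_compose[OF fc cT]) auto
    have YP: "\<bar>Y \<psi> - P \<psi>\<bar> \<le> 2 * e' * n" for \<psi>
    proof -
      have "\<bar>avg f (z j) - avg p (z j)\<bar> \<le> e'" if "j < n" for j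
      proof -
        have "avg f (z j) - avg p (z j) = (LINT \<theta>|m0. f (z j) \<theta> - p (z j) \<theta>)"
          unfolding avg_def using z that
          by (subst Bochner_Integration.integral_diff) (auto intro!: integrable_bdd_continuous fc pc)
        also have "\<bar>\<dots>\<bar> \<le> (LINT \<theta>|m0. \<bar>f (z j) \<theta> - p (z j) \<theta>\<bar>)" by (rule integral_abs_bound)
        also have "\<dots> \<le> (LINT \<theta>|m0. e')"
          using z that p(2)
          by (intro integral_mono integrable_bdd_continuous bdd_continuous_intros
                bdd_continuous_norm[where 'a=real, unfolded real_norm_def] fc pc) (auto intro: less_imp_le)
        finally show ?thesis by simp
      qed
      then have "\<bar>(f (z j) (T j \<psi>) - avg f (z j)) - (p (z j) (T j \<psi>) - avg p (z j))\<bar> \<le> 2 * e'" if "j < n" for j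
        using p(2)[of "z j" "T j \<psi>"] z that by fastforce
      then have "(\<Sum>j<n. \<bar>(f (z j) (T j \<psi>) - avg f (z j)) - (p (z j) (T j \<psi>) - avg p (z j))\<bar>) \<le> (\<Sum>j<n. 2 * e')"
        by (intro sum_mono) auto
      then have "(\<Sum>j<n. \<bar>(f (z j) (T j \<psi>) - avg f (z j)) - (p (z j) (T j \<psi>) - avg p (z j))\<bar>) \<le> 2 * e' * n"
        by (simp add: mult_ac)
      then show ?thesis unfolding Y_def P_def sum_subtractf[symmetric]
        by (rule order_trans[OF sum_abs])
    qed
    have "(LINT \<psi>|m0. (Y \<psi>)\<^sup>2) \<le> (LINT \<psi>|m0. 2 * (P \<psi>)\<^sup>2 + 2 * (2 * e' * n)\<^sup>2)"
    proof (intro integral_mono integrable_bdd_continuous bdd_continuous_intros bP bY)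
      fix \<psi>
      have "(Y \<psi>)\<^sup>2 = (P \<psi> + (Y \<psi> - P \<psi>))\<^sup>2" by simp
      also have "\<dots> \<le> 2 * (P \<psi>)\<^sup>2 + 2 * (Y \<psi> - P \<psi>)\<^sup>2"
        using sum_squares_bound[of "P \<psi>" "Y \<psi> - P \<psi>"] unfolding power2_sum by linarith
      also have "(Y \<psi> - P \<psi>)\<^sup>2 \<le> (2 * e' * n)\<^sup>2"
        using power_mono[OF YP abs_ge_zero, of \<psi> 2] by simp
      finally show "(Y \<psi>)\<^sup>2 \<le> 2 * (P \<psi>)\<^sup>2 + 2 * (2 * e' * n)\<^sup>2" by simp
    qed
    also have "\<dots> = 2 * (LINT \<psi>|m0. (P \<psi>)\<^sup>2) + 2 * (2 * e' * n)\<^sup>2"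
      by (subst Bochner_Integration.integral_add)
         (auto intro!: integrable_bdd_continuous bdd_continuous_intros bP)
    also have "(LINT \<psi>|m0. (P \<psi>)\<^sup>2) \<le> C * n"
    proof -
      have "(\<Sum>j<n. complex_of_real (p (z j) (T j \<psi>)) - (LINT \<theta>|m0. complex_of_real (p (z j) \<theta>)))
          = complex_of_real (P \<psi>)" for \<psi>
        by (simp add: P_def avg_def)
      then show ?thesis
        using C[THEN spec, THEN spec, THEN spec, THEN mp, OF T, THEN mp, OF z] by simp
    qed
    also have "2 * (2 * e' * n)\<^sup>2 = e * (real n)\<^sup>2"
      unfolding e'(2)[symmetric] by (simp add: power_mult_distrib)
    finally show ?thesis by (simp add: Y_def)
  qed
  then show ?thesis by blast
qed

text \<open>Markov's inequality for the squared sums at no more than \<open>M\<close> checkpoints,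
  followed by a union bound. The threshold \<open>n0\<close> is the same for all free families and
  all choices of the points \<open>z j\<close>.\<close>

lemma maximal_weak_law:
  fixes f :: "real \<Rightarrow> real^2 \<Rightarrow> real"
  assumes cont: "continuous_on ({-R..R} \<times> UNIV) (\<lambda>(z, \<psi>). f z \<psi>)"
    and per: "\<And>z. torus_fun (f z)" and bnd: "\<And>z \<psi>. \<bar>f z \<psi>\<bar> \<le> 1" and "\<eta> > 0"
  obtains n0 where "\<And>n T z. n \<ge> n0 \<Longrightarrow> free_family T \<Longrightarrow> \<forall>j<n. \<bar>z j\<bar> \<le> R \<Longrightarrow>
     \<exists>E\<in>sets m0. measure m0 E \<le> \<eta> \<and>
       (\<forall>\<psi>. \<psi> \<notin> E \<longrightarrow> (\<forall>k\<le>n. \<bar>\<Sum>j<k. f (z j) (T j \<psi>) - avg f (z j)\<bar> \<le> \<eta> * real n))"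
proof -
  \<comment> \<open>With this \<open>M\<close> a gap of about \<open>n / M\<close> indices moves the
    sum by a small fraction of \<open>\<eta> * n\<close>.\<close>
  define M where "M = Suc (nat \<lceil>8 / \<eta>\<rceil>)"
  have M: "real M \<ge> 8 / \<eta>" "M > 0" unfolding M_def by linarith+
  \<comment> \<open>Markov's bound at one checkpoint will be \<open>8 * e / \<eta>\<^sup>2\<close>,
    which is \<open>\<eta> / M\<close>.\<close>
  define e where "e = \<eta> ^ 3 / (8 * real M)"
  have "e > 0" using \<open>\<eta> > 0\<close> M by (simp add: e_def)
  obtain C where C: "\<forall>T z n. free_family T \<longrightarrow> (\<forall>j<n. \<bar>z j\<bar> \<le> R) \<longrightarrow>
     (LINT \<psi>|m0. (\<Sum>j<n. f (z j) (T j \<psi>) - avg f (z j))\<^sup>2) \<le> e * (real n)\<^sup>2 + C * real n"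
    using centred_sum_second_moment[OF cont per \<open>e > 0\<close>] by (rule exE)
  \<comment> \<open>The first bound absorbs the rounding in \<open>q\<close>; the second makes the
    linear term \<open>\<bar>C\<bar> * n\<close> at most the quadratic one.\<close>
  define n0 where "n0 = Suc (nat \<lceil>max (8 / \<eta>) (8 * \<bar>C\<bar> * real M / \<eta> ^ 3)\<rceil>)"
  have "\<exists>E\<in>sets m0. measure m0 E \<le> \<eta> \<and>
       (\<forall>\<psi>. \<psi> \<notin> E \<longrightarrow> (\<forall>k\<le>n. \<bar>\<Sum>j<k. f (z j) (T j \<psi>) - avg f (z j)\<bar> \<le> \<eta> * real n))"
    if n: "n \<ge> n0" and T: "free_family T" and z: "\<forall>j<n. \<bar>z j\<bar> \<le> R" for n T z
  proof -
    have "real n \<ge> max (8 / \<eta>) (8 * \<bar>C\<bar> * real M / \<eta> ^ 3)" "n > 0"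
      using n unfolding n0_def by linarith+
    then have n': "real n \<ge> 8 / \<eta>" "real n \<ge> 8 * \<bar>C\<bar> * real M / \<eta> ^ 3" "n > 0" by auto
    define Y where "Y k \<psi> = (\<Sum>j<k. f (z j) (T j \<psi>) - avg f (z j))" for k \<psi>
    \<comment> \<open>The successor ensures \<open>n < q * M\<close>, so every
      \<open>k \<le> n\<close> lies less than \<open>q\<close> above a checkpoint with index below
      \<open>M\<close>.\<close>
    define q where "q = Suc (n div M)"
    define I where "I = {i. i < M \<and> i * q \<le> n}"
    define B where "B i = {\<psi>. (Y (i * q) \<psi>)\<^sup>2 \<ge> (\<eta> * n / 2)\<^sup>2}" for i
    have cT: "continuous_on UNIV (T j)" for j using T by (auto simp: free_family_def)
    have fc: "bdd_continuous (f (z j))" if "j < n" for j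
      using torus_bdd_continuous[OF cont per] z that by auto
    have bY: "bdd_continuous (Y k)" if "k \<le> n" for k unfolding Y_def
      using that by (intro bdd_continuous_intros bdd_continuous_compose[OF fc cT]) auto
    have avg1: "\<bar>avg f (z j)\<bar> \<le> 1" if "j < n" for j
    proof -
      have "\<bar>avg f (z j)\<bar> \<le> (LINT \<theta>|m0. \<bar>f (z j) \<theta>\<bar>)" unfolding avg_def by (rule integral_abs_bound)
      also have "\<dots> \<le> (LINT \<theta>|m0. 1)"
        using that bnd
        by (intro integral_mono integrable_bdd_continuous bdd_continuous_intros
              bdd_continuous_norm[where 'a=real, unfolded real_norm_def] fc) auto
      finally show ?thesis by simp
    qed
    have incr: "\<bar>Y (k + d) \<psi>\<bar> \<le> \<bar>Y k \<psi>\<bar> + 2 * real d" if "k + d \<le> n" for k d \<psi>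
      using that
    proof (induction d)
      case (Suc d)
      have "\<bar>f (z (k + d)) (T (k + d) \<psi>) - avg f (z (k + d))\<bar> \<le> 2"
        using bnd[of "z (k + d)" "T (k + d) \<psi>"] avg1[of "k + d"] Suc.prems by linarith
      moreover have "Y (k + Suc d) \<psi> = Y (k + d) \<psi> + (f (z (k + d)) (T (k + d) \<psi>) - avg f (z (k + d)))"
        by (simp add: Y_def)
      ultimately show ?case using Suc by simp
    qed simp
    have q: "2 * real q \<le> \<eta> * n / 2"
    proof -
      have "real (n div M * M) \<le> real n" by (simp only: of_nat_le_iff div_times_less_eq_dividend)
      then have "real q \<le> n / M + 1" using M(2) by (simp add: q_def field_simps)
      moreover have "n / M \<le> \<eta> * n / 8" 
        using M \<open>\<eta> > 0\<close> mult_right_mono[of 8 "\<eta> * M" "real n"] by (simp add: field_simps)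
      moreover have "1 \<le> \<eta> * n / 8" using n'(1) \<open>\<eta> > 0\<close> by (simp add: field_simps)
      ultimately show ?thesis by linarith
    qed
    \<comment> \<open>The summands are bounded, so controlling the sums at multiples of \<open>q\<close> suffices.\<close>
    have sub: "{\<psi>. \<exists>k\<le>n. \<bar>Y k \<psi>\<bar> > \<eta> * n} \<subseteq> (\<Union>i\<in>I. B i)"
    proof clarify
      fix \<psi> k assume k: "k \<le> n" "\<bar>Y k \<psi>\<bar> > \<eta> * n"
      have "n < q * M" using dividend_less_times_div[of M n] M(2) by (simp add: q_def mult.commute)
      then have "k div q < M" using k(1) by (simp add: less_mult_imp_div_less mult.commute)
      moreover have le: "k div q * q \<le> k" by (simp add: div_times_less_eq_dividend)
      ultimately have "k div q \<in> I" using le_trans[OF le k(1)] by (simp add: I_def)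
      have "\<bar>Y k \<psi>\<bar> \<le> \<bar>Y (k div q * q) \<psi>\<bar> + 2 * real (k mod q)"
        using incr[of "k div q * q" "k mod q" \<psi>] k(1) by simp
      also have "real (k mod q) \<le> real q"
        unfolding of_nat_le_iff by (intro less_imp_le mod_less_divisor) (simp add: q_def)
      finally have "\<bar>Y (k div q * q) \<psi>\<bar> \<ge> \<eta> * n / 2" using q k(2) by linarith
      then have "\<psi> \<in> B (k div q)"
        using \<open>\<eta> > 0\<close> unfolding B_def by (simp add: power2_le_iff_abs_le abs_le_square_iff[symmetric])
      with \<open>k div q \<in> I\<close> show "\<psi> \<in> (\<Union>i\<in>I. B i)" by blast
    qed
    have meas: "B i \<in> sets m0" if "i \<in> I" for i
    proof -
      have "continuous_on UNIV (\<lambda>\<psi>. (Y (i * q) \<psi>)\<^sup>2)"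
        using bY[of "i * q"] that by (auto simp: I_def bdd_continuous_def intro!: continuous_intros)
      then have "closed (B i)" unfolding B_def by (intro closed_Collect_le continuous_on_const)
      then show ?thesis by simp
    qed
    have mB: "measure m0 (B i) \<le> \<eta> / M" if i: "i \<in> I" for i
    proof -
      have le: "i * q \<le> n" using i by (simp add: I_def)
      then have z': "\<forall>j<i * q. \<bar>z j\<bar> \<le> R" using z by auto
      have c: "(\<eta> * n / 2)\<^sup>2 > 0" using \<open>\<eta> > 0\<close> n'(3) by simp
      have "measure m0 (B i) \<le> (LINT \<psi>|m0. (Y (i * q) \<psi>)\<^sup>2) / (\<eta> * n / 2)\<^sup>2"
        using integral_Markov_inequality_measure[of m0 "\<lambda>\<psi>. (Y (i * q) \<psi>)\<^sup>2" "{}" "(\<eta> * n / 2)\<^sup>2"] c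
          integrable_bdd_continuous[OF bdd_continuous_power2[OF bY[OF le]]]
        by (simp add: B_def)
      also have "(LINT \<psi>|m0. (Y (i * q) \<psi>)\<^sup>2) \<le> e * (real (i * q))\<^sup>2 + C * real (i * q)"
        using C[THEN spec, THEN spec, THEN spec, THEN mp, OF T, THEN mp, OF z'] by (simp add: Y_def)
      also have "\<dots> \<le> e * (real n)\<^sup>2 + \<bar>C\<bar> * real n"
        using of_nat_mono[OF le, where 'a = real] \<open>e > 0\<close>
        by (intro add_mono mult_mono power_mono) auto
      also have "\<dots> \<le> 2 * (e * (real n)\<^sup>2)"
      proof -
        have "\<bar>C\<bar> \<le> e * n"
          using n'(2) \<open>\<eta> > 0\<close> M(2) by (simp add: e_def field_simps)
        then have "\<bar>C\<bar> * n \<le> e * n * n" by (intro mult_right_mono) auto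
        then show ?thesis by (simp add: power2_eq_square mult.assoc)
      qed
      also have "\<dots> / (\<eta> * n / 2)\<^sup>2 = \<eta> / M"
        using \<open>\<eta> > 0\<close> n'(3) M(2) by (simp add: e_def power_mult_distrib power2_eq_square power3_eq_cube field_simps)
      finally show ?thesis using c by (simp add: divide_right_mono)
    qed
    have "finite I" "card I \<le> M"
    proof -
      have "I \<subseteq> {..<M}" by (auto simp: I_def)
      then show "finite I" "card I \<le> M"
        using finite_subset card_mono[of "{..<M}" I] by auto
    qed
    have "measure m0 (\<Union>i\<in>I. B i) \<le> (\<Sum>i\<in>I. measure m0 (B i))"
      using meas \<open>finite I\<close> by (intro m0.finite_measure_subadditive_finite) auto
    also have "\<dots> \<le> (\<Sum>i\<in>I. \<eta> / M)" by (intro sum_mono mB)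
    also have "\<dots> \<le> \<eta>"
      using \<open>card I \<le> M\<close> \<open>\<eta> > 0\<close> M(2) by (simp add: field_simps)
    finally have "measure m0 (\<Union>i\<in>I. B i) \<le> \<eta>" .
    moreover have "(\<Union>i\<in>I. B i) \<in> sets m0" using meas \<open>finite I\<close> by auto
    moreover have "\<forall>k\<le>n. \<bar>Y k \<psi>\<bar> \<le> \<eta> * n" if "\<psi> \<notin> (\<Union>i\<in>I. B i)" for \<psi>
    proof (rule ccontr)
      assume "\<not> ?thesis"
      then have "\<psi> \<in> {\<psi>. \<exists>k\<le>n. \<bar>Y k \<psi>\<bar> > \<eta> * n}" by (simp add: not_le)
      from subsetD[OF sub this] that show False by (rule notE[rotated])
    qed
    ultimately have "\<exists>E\<in>sets m0. measure m0 E \<le> \<eta> \<and>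
       (\<forall>\<psi>. \<psi> \<notin> E \<longrightarrow> (\<forall>k\<le>n. \<bar>Y k \<psi>\<bar> \<le> \<eta> * real n))"
      by (intro bexI[of _ "\<Union>i\<in>I. B i"] conjI allI impI) simp_all
    then show ?thesis unfolding Y_def .
  qed
  then show thesis using that by blast
qed

section \<open>Regularity of functions in the Hoelder space\<close>

lemma norm_torus_lattice_ge:
  assumes "l \<in> torus_lattice" "l \<noteq> 0"
  shows "2 * pi \<le> norm l"
proof -
  obtain i where i: "l $ i \<noteq> 0" using assms(2) by (auto simp: vec_eq_iff)
  obtain n :: int where n: "l $ i = 2 * pi * of_int n" using assms(1) by (auto simp: torus_lattice_def)
  have "n \<noteq> 0" using i n by auto
  then have "1 \<le> \<bar>real_of_int n\<bar>" by linarith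
  then have "2 * pi \<le> \<bar>l $ i\<bar>" by (simp add: n abs_mult)
  also have "\<dots> \<le> norm l" by (rule component_le_norm_cart)
  finally show ?thesis .
qed

text \<open>Nonzero lattice vectors have length at least \<open>2 * pi\<close>, so 0 is the lattice
  point nearest to a vector of length at most 1.\<close>

lemma torus_dist_eq_norm:
  assumes "norm (\<psi>' - \<psi>) \<le> 1"
  shows "torus_dist \<psi> \<psi>' = norm (\<psi>' - \<psi>)"
proof -
  have 0: "0 \<in> torus_lattice" by (auto simp: torus_lattice_def intro!: exI[of _ 0])
  have "norm (\<psi>' - \<psi>) \<le> dist (\<psi>' - \<psi>) l" if "l \<in> torus_lattice" for l
  proof (cases "l = 0")
    case False
    have "norm l \<le> norm (\<psi>' - \<psi>) + dist (\<psi>' - \<psi>) l"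
      by (metis dist_norm dist_commute norm_triangle_sub)
    then show ?thesis using norm_torus_lattice_ge[OF that False] assms pi_gt3 by linarith
  qed simp
  then have "norm (\<psi>' - \<psi>) \<le> infdist (\<psi>' - \<psi>) torus_lattice"
    using 0 unfolding infdist_def by (auto intro!: cINF_greatest)
  moreover have "infdist (\<psi>' - \<psi>) torus_lattice \<le> norm (\<psi>' - \<psi>)"
    using infdist_le[OF 0, of "\<psi>' - \<psi>"] by simp
  ultimately show ?thesis by (simp add: torus_dist_def)
qed

lemma dphi_0 [simp]: "dphi 0 g = g"
  by (simp add: dphi_def fun_eq_iff)

lemma B_space_dphi_deriv:
  assumes "g \<in> B_space \<alpha> k" "n < k"
  shows "((\<lambda>x. dphi n g x \<psi>) has_real_derivative dphi (Suc n) g x \<psi>) (at x)"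
proof -
  have "(\<lambda>x. dphi n g x \<psi>) differentiable at x" using assms by (auto simp: B_space_def)
  then show ?thesis
    by (simp add: dphi_def field_differentiable_derivI real_differentiable_def
        field_differentiable_def DERIV_deriv_iff_real_differentiable[unfolded real_differentiable_def])
qed

lemma B_norm_abs_dphi_le:
  assumes "B_norm \<alpha> k g = 1" "n \<le> k"
  shows "\<bar>dphi n g x \<psi>\<bar> \<le> 1"
proof -
  have "ennreal \<bar>dphi n g x \<psi>\<bar> \<le> sup_norm (dphi n g)"
    unfolding sup_norm_def by (rule SUP_upper2[of "(x, \<psi>)"]) auto
  also have "\<dots> \<le> (\<Sum>n\<le>k. sup_norm (dphi n g))"
    using assms(2) by (intro member_le_sum) auto
  also have "\<dots> \<le> B_norm \<alpha> k g" by (simp add: B_norm_def)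
  finally show ?thesis by (simp add: assms(1))
qed

text \<open>The factor \<open>1 / \<alpha>\<close> undoes the weight \<alpha> of the Hoelder
  seminorms in \<open>B_norm\<close>.\<close>

lemma B_norm_holder:
  assumes "B_norm \<alpha> k g = 1" "0 < k" "0 < \<alpha>" "norm (\<psi>' - \<psi>) \<le> 1"
  shows "\<bar>g x \<psi>' - g x \<psi>\<bar> \<le> norm (\<psi>' - \<psi>) powr \<alpha> / \<alpha>"
proof (cases "\<psi>' = \<psi>")
  case False
  let ?h = "\<bar>g x \<psi>' - g x \<psi>\<bar> / torus_dist \<psi> \<psi>' powr \<alpha>"
  have "ennreal (\<alpha> * ?h) \<le> ennreal \<alpha> * holder_seminorm \<alpha> (dphi 0 g)"
    unfolding holder_seminorm_def using assms(3)
    by (subst ennreal_mult) (auto intro!: mult_left_mono SUP_upper2[of "(x, \<psi>, \<psi>')"])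
  also have "\<dots> \<le> ennreal \<alpha> * (\<Sum>n<k. holder_seminorm \<alpha> (dphi n g))"
    using assms(2) by (intro mult_left_mono member_le_sum) auto
  also have "\<dots> \<le> B_norm \<alpha> k g" by (simp add: B_norm_def)
  finally have "\<alpha> * ?h \<le> 1" by (simp add: assms(1))
  then show ?thesis
    using False assms(3) by (simp add: torus_dist_eq_norm[OF assms(4)] field_simps)
qed simp

text \<open>Joint continuity: the Lipschitz bound in \<open>x\<close> is uniform in \<psi>, so one
  may first move \<open>x\<close> with \<psi> held fixed and then move \<psi> at
  \<open>x0\<close>.\<close>

lemma continuous_on_lipschitz_holder:
  fixes g :: "real \<Rightarrow> real^2 \<Rightarrow> real"
  assumes lip: "\<And>x y \<psi>. \<bar>g x \<psi> - g y \<psi>\<bar> \<le> \<bar>x - y\<bar>"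
    and holder: "\<And>x \<psi> \<psi>'. norm (\<psi>' - \<psi>) \<le> 1 \<Longrightarrow> \<bar>g x \<psi>' - g x \<psi>\<bar> \<le> norm (\<psi>' - \<psi>) powr \<alpha> / \<alpha>"
    and "0 < \<alpha>"
  shows "continuous_on S (\<lambda>(x, \<psi>). g x \<psi>)"
proof (rule continuous_at_imp_continuous_on, clarify)
  fix x0 :: real and \<psi>0 :: "real^2"
  let ?F = "at (x0, \<psi>0)"
  have "((\<lambda>p. norm (snd p - \<psi>0)) \<longlongrightarrow> 0) ?F"
    by (auto intro!: tendsto_eq_intros)
  then have small: "\<forall>\<^sub>F p in ?F. norm (snd p - \<psi>0) < 1"
    and "((\<lambda>p. norm (snd p - \<psi>0) powr \<alpha>) \<longlongrightarrow> 0) ?F"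
    using assms(3) by (auto intro!: order_tendstoD(2) tendsto_zero_powrI)
  then have lim: "((\<lambda>p. \<bar>fst p - x0\<bar> + norm (snd p - \<psi>0) powr \<alpha> / \<alpha>) \<longlongrightarrow> 0) ?F"
    using assms(3) by (auto intro!: tendsto_eq_intros)
  have "((\<lambda>p. g (fst p) (snd p) - g x0 \<psi>0) \<longlongrightarrow> 0) ?F"
  proof (rule Lim_null_comparison[OF _ lim])
    show "\<forall>\<^sub>F p in ?F. norm (g (fst p) (snd p) - g x0 \<psi>0) \<le> \<bar>fst p - x0\<bar> + norm (snd p - \<psi>0) powr \<alpha> / \<alpha>"
      using small
    proof eventually_elim
      case (elim p)
      have "\<bar>g x0 (snd p) - g x0 \<psi>0\<bar> \<le> norm (snd p - \<psi>0) powr \<alpha> / \<alpha>"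
        using elim by (intro holder) simp
      then show ?case using lip[of "fst p" "snd p" x0] by simp
    qed
  qed
  then show "isCont (\<lambda>(x, \<psi>). g x \<psi>) (x0, \<psi>0)"
    by (simp add: isCont_def case_prod_unfold LIM_zero_iff)
qed

section \<open>Deterministic estimates\<close>

text \<open>The minimum over the compact box is a minimum over the whole plane by periodicity. For
  an empty interval any positive constant serves.\<close>

lemma torus_positive_lower_bound:
  fixes g :: "real \<Rightarrow> real^2 \<Rightarrow> real"
  assumes cont: "continuous_on ({l..u} \<times> UNIV) (\<lambda>(x, \<psi>). g x \<psi>)"
    and per: "\<And>x. torus_fun (g x)"
    and pos: "\<And>x \<psi>. x \<in> {l..u} \<Longrightarrow> 0 < g x \<psi>"
  obtains c where "c > 0" "\<And>x \<psi>. x \<in> {l..u} \<Longrightarrow> c \<le> g x \<psi>"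
proof (cases "l \<le> u")
  case True
  let ?K = "{l..u} \<times> torus_box"
  have "compact ?K" unfolding torus_box_def by (intro compact_Times) auto
  moreover have "?K \<noteq> {}" using True torus_box_representative by fastforce
  moreover have "continuous_on ?K (\<lambda>(x, \<psi>). g x \<psi>)" by (rule continuous_on_subset[OF cont]) auto
  ultimately obtain p where p: "p \<in> ?K" "\<And>q. q \<in> ?K \<Longrightarrow> (case p of (x, \<psi>) \<Rightarrow> g x \<psi>) \<le> (case q of (x, \<psi>) \<Rightarrow> g x \<psi>)"
    using continuous_attains_inf by metis
  obtain x0 \<psi>0 where p0: "p = (x0, \<psi>0)" by fastforce
  show thesis
  proof
    show "0 < g x0 \<psi>0" using p p0 by (auto intro: pos)
    fix x \<psi> assume x: "x \<in> {l..u}"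
    obtain \<psi>' where \<psi>': "\<psi>' \<in> torus_box" "\<And>i. cis (\<psi>' $ i) = cis (\<psi> $ i)"
      using torus_box_representative[of \<psi>] by blast
    have "g x0 \<psi>0 \<le> g x \<psi>'" using p(2)[of "(x, \<psi>')"] x \<psi>' by (simp add: p0)
    then show "g x0 \<psi>0 \<le> g x \<psi>" using torus_fun_eqI[OF per \<psi>'(2)] by simp
  qed
qed (use that[of 1] in auto)

text \<open>Only the forcing \<open>R\<close> itself is small, not the sum of its absolute
  increments. The induction therefore runs on \<open>d - R\<close>, where those increments have
  cancelled.\<close>

lemma discrete_gronwall:
  fixes d R :: "nat \<Rightarrow> real"
  assumes "0 \<le> \<rho>" "0 \<le> \<beta>" "0 \<le> \<epsilon>" "d 0 = R 0"
    and step: "\<And>k. k < m \<Longrightarrow> \<bar>d (Suc k) - d k - (R (Suc k) - R k)\<bar> \<le> \<rho> * \<bar>d k\<bar> + \<rho> * \<epsilon>"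
    and R: "\<And>k. k \<le> m \<Longrightarrow> \<bar>R k\<bar> \<le> \<beta>"
    and "k \<le> m"
  shows "\<bar>d k\<bar> \<le> (\<beta> + \<epsilon>) * exp (\<rho> * real k)"
proof -
  have "\<bar>d k - R k\<bar> \<le> (\<beta> + \<epsilon>) * ((1 + \<rho>) ^ k - 1)"
    using \<open>k \<le> m\<close>
  proof (induction k)
    case (Suc k)
    have "\<bar>d k\<bar> \<le> \<bar>d k - R k\<bar> + \<beta>" using R[of k] Suc.prems by linarith
    then have "\<rho> * \<bar>d k\<bar> \<le> \<rho> * (\<bar>d k - R k\<bar> + \<beta>)" using assms(1) by (intro mult_left_mono)
    then have "\<bar>d (Suc k) - R (Suc k)\<bar> \<le> (1 + \<rho>) * \<bar>d k - R k\<bar> + \<rho> * (\<beta> + \<epsilon>)"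
      using step[of k] Suc.prems by (simp add: algebra_simps)
    also have "\<dots> \<le> (1 + \<rho>) * ((\<beta> + \<epsilon>) * ((1 + \<rho>) ^ k - 1)) + \<rho> * (\<beta> + \<epsilon>)"
      using Suc assms(1) by (intro add_mono mult_left_mono) auto
    also have "\<dots> = (\<beta> + \<epsilon>) * ((1 + \<rho>) ^ Suc k - 1)" by (simp add: algebra_simps)
    finally show ?case .
  qed (simp add: assms)
  moreover have "\<bar>R k\<bar> \<le> \<beta>" using R \<open>k \<le> m\<close> by blast
  moreover have "(\<beta> + \<epsilon>) * (1 + \<rho>) ^ k \<le> (\<beta> + \<epsilon>) * exp (\<rho> * real k)"
  proof (intro mult_left_mono)
    have "(1 + \<rho>) ^ k \<le> exp \<rho> ^ k"
      using exp_ge_add_one_self[of \<rho>] assms(1) by (intro power_mono) auto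
    then show "(1 + \<rho>) ^ k \<le> exp (\<rho> * real k)" by (simp add: exp_of_nat_mult[symmetric] mult.commute)
  qed (use assms in auto)
  ultimately show ?thesis using assms(2,3) by (simp add: algebra_simps)
qed

lemma contraction_power_le_exp:
  assumes "0 \<le> \<rho> * \<kappa>" "\<rho> * \<kappa> \<le> 1"
  shows "(1 - \<rho> * \<kappa>) ^ n \<le> exp (- (\<kappa> * (\<rho> * real n)))"
proof -
  have "(1 - \<rho> * \<kappa>) ^ n \<le> exp (- (\<rho> * \<kappa>)) ^ n"
    using exp_ge_add_one_self[of "- (\<rho> * \<kappa>)"] assms by (intro power_mono) auto
  then show ?thesis by (simp add: exp_of_nat_mult[symmetric] mult_ac)
qed

text \<open>\<open>f'\<close> stands for the derivative in the slow variable, and the constants 1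
  reflect the normalisation of the norm. The sign conditions confine the zeros of \<open>f\<close>
  between \<phi>m and \<phi>M to the strip from \<open>Sm\<close> to \<open>SM\<close>.\<close>

locale averaging_setting =
  fixes f f' :: "real \<Rightarrow> real^2 \<Rightarrow> real" and \<phi>m \<phi>M Sm SM \<gamma> :: real
  assumes deriv: "\<And>x \<psi>. ((\<lambda>x. f x \<psi>) has_real_derivative f' x \<psi>) (at x)"
    and f_bound: "\<And>x \<psi>. \<bar>f x \<psi>\<bar> \<le> 1" and f'_bound: "\<And>x \<psi>. \<bar>f' x \<psi>\<bar> \<le> 1"
    and f'_lip: "\<And>x y \<psi>. \<bar>f' x \<psi> - f' y \<psi>\<bar> \<le> \<bar>x - y\<bar>"
    and cont: "\<And>U. continuous_on U (\<lambda>(x, \<psi>). f x \<psi>)"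
    and per: "\<And>x. torus_fun (f x)"
    and order: "\<phi>m \<le> Sm" "Sm \<le> 0" "0 \<le> SM" "SM \<le> \<phi>M"
    and end_pos: "\<And>\<psi>. 0 < f \<phi>m \<psi>" and end_neg: "\<And>\<psi>. f \<phi>M \<psi> < 0"
    and pos: "\<And>x \<psi>. x \<in> {\<phi>m..<Sm} \<Longrightarrow> 0 < f x \<psi>"
    and neg: "\<And>x \<psi>. x \<in> {SM<..\<phi>M} \<Longrightarrow> f x \<psi> < 0"
    and slope: "\<And>x \<psi>. x \<in> {Sm..SM} \<Longrightarrow> f' x \<psi> \<le> - \<gamma>"
    and \<gamma>_pos: "0 < \<gamma>"
    and avg_0: "avg f 0 = 0"
begin

section \<open>Lipschitz bounds for the drift and its average\<close>

lemma mean_value: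
  fixes x y :: real
  obtains \<zeta> where "min x y \<le> \<zeta>" "\<zeta> \<le> max x y" "f x \<psi> - f y \<psi> = f' \<zeta> \<psi> * (x - y)"
proof (cases x y rule: linorder_cases)
  case less
  then obtain \<zeta> where "x < \<zeta>" "\<zeta> < y" "f y \<psi> - f x \<psi> = (y - x) * f' \<zeta> \<psi>"
    using MVT2[of x y "\<lambda>x. f x \<psi>" "\<lambda>x. f' x \<psi>"] deriv by blast
  then show thesis by (intro that[of \<zeta>]) (auto simp: algebra_simps)
next
  case greater
  then obtain \<zeta> where "y < \<zeta>" "\<zeta> < x" "f x \<psi> - f y \<psi> = (x - y) * f' \<zeta> \<psi>"
    using MVT2[of y x "\<lambda>x. f x \<psi>" "\<lambda>x. f' x \<psi>"] deriv by blast
  then show thesis by (intro that[of \<zeta>]) (auto simp: algebra_simps)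
qed (use that in auto)

lemma f_lip: "\<bar>f x \<psi> - f y \<psi>\<bar> \<le> \<bar>x - y\<bar>"
proof -
  obtain \<zeta> where "f x \<psi> - f y \<psi> = f' \<zeta> \<psi> * (x - y)" by (rule mean_value)
  then show ?thesis using mult_right_mono[OF f'_bound[of \<zeta> \<psi>], of "\<bar>x - y\<bar>"] by (simp add: abs_mult)
qed

lemma f_bdd_continuous: "bdd_continuous (f x)"
  using torus_bdd_continuous[OF cont per, of x "\<bar>x\<bar>"] by simp

lemma avg_lip: "\<bar>avg f x - avg f y\<bar> \<le> \<bar>x - y\<bar>"
proof -
  have "avg f x - avg f y = (LINT \<psi>|m0. f x \<psi> - f y \<psi>)"
    unfolding avg_def
    by (subst Bochner_Integration.integral_diff) (auto intro!: integrable_bdd_continuous f_bdd_continuous)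
  also have "\<bar>\<dots>\<bar> \<le> (LINT \<psi>|m0. \<bar>f x \<psi> - f y \<psi>\<bar>)" by (rule integral_abs_bound)
  also have "\<dots> \<le> (LINT \<psi>|m0. \<bar>x - y\<bar>)"
    by (intro integral_mono integrable_bdd_continuous bdd_continuous_intros
          bdd_continuous_norm[where 'a=real, unfolded real_norm_def] f_bdd_continuous f_lip)
  finally show ?thesis by simp
qed

lemma avg_bound: "\<bar>avg f x\<bar> \<le> 1"
proof -
  have "\<bar>avg f x\<bar> \<le> (LINT \<psi>|m0. \<bar>f x \<psi>\<bar>)" unfolding avg_def by (rule integral_abs_bound)
  also have "\<dots> \<le> (LINT \<psi>|m0. 1)"
    by (intro integral_mono integrable_bdd_continuous bdd_continuous_intros
          bdd_continuous_norm[where 'a=real, unfolded real_norm_def] f_bdd_continuous f_bound)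
  finally show ?thesis by simp
qed

text \<open>The drift is 1-Lipschitz, so a step of size at most 1 preserves order. Orbits can thus
  be trapped between barriers.\<close>

lemma step_mono:
  assumes "0 \<le> \<rho>" "\<rho> \<le> 1" "x \<le> y"
  shows "x + \<rho> * f x \<psi> \<le> y + \<rho> * f y \<psi>"
proof -
  have "\<rho> * (f x \<psi> - f y \<psi>) \<le> \<rho> * (y - x)"
    using f_lip[of x \<psi> y] assms by (intro mult_left_mono) auto
  also have "\<dots> \<le> y - x" using assms by (simp add: mult_left_le_one_le)
  finally show ?thesis by (simp add: algebra_simps)
qed

lemma \<gamma>_le_1: "\<gamma> \<le> 1"
  using slope[of 0 0] f'_bound[of 0 0] order by simp

text \<open>\<open>f'\<close> is 1-Lipschitz, so leaving the strip by
  \<open>\<gamma> - \<kappa>\<close> costs at most that much slope.\<close>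

lemma slope_near:
  assumes "x \<in> {Sm - (\<gamma> - \<kappa>)..SM + (\<gamma> - \<kappa>)}" "\<kappa> \<le> \<gamma>"
  shows "f' x \<psi> \<le> - \<kappa>"
proof -
  define y where "y = max Sm (min SM x)"
  have "y \<in> {Sm..SM}" "\<bar>x - y\<bar> \<le> \<gamma> - \<kappa>" using assms order by (auto simp: y_def)
  then show ?thesis using slope[of y \<psi>] f'_lip[of x \<psi> y] by linarith
qed

text \<open>By the mean value theorem the difference is multiplied by
  \<open>1 + \<rho> * f'\<close>, which is nonnegative since \<open>\<rho> \<le> 1\<close> and at
  most \<open>1 - \<rho> * \<kappa>\<close> near the strip.\<close>

lemma step_contraction:
  assumes "0 \<le> \<rho>" "\<rho> \<le> 1" "\<kappa> \<le> \<gamma>"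
    and "x \<in> {Sm - (\<gamma> - \<kappa>)..SM + (\<gamma> - \<kappa>)}" "w \<in> {Sm - (\<gamma> - \<kappa>)..SM + (\<gamma> - \<kappa>)}"
  shows "\<bar>x + \<rho> * f x \<psi> - (w + \<rho> * f w \<psi>)\<bar> \<le> (1 - \<rho> * \<kappa>) * \<bar>x - w\<bar>"
proof -
  obtain \<zeta> where \<zeta>: "min x w \<le> \<zeta>" "\<zeta> \<le> max x w" "f x \<psi> - f w \<psi> = f' \<zeta> \<psi> * (x - w)"
    by (rule mean_value)
  have "f' \<zeta> \<psi> \<le> - \<kappa>" using \<zeta>(1,2) assms by (intro slope_near) auto
  then have "\<rho> * f' \<zeta> \<psi> \<le> \<rho> * (- \<kappa>)" using assms(1) by (rule mult_left_mono)
  moreover have "\<rho> * (- 1) \<le> \<rho> * f' \<zeta> \<psi>"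
    using f'_bound[of \<zeta> \<psi>] assms(1) by (intro mult_left_mono) auto
  ultimately have "\<bar>1 + \<rho> * f' \<zeta> \<psi>\<bar> \<le> 1 - \<rho> * \<kappa>" using assms(2) by auto
  moreover have "x + \<rho> * f x \<psi> - (w + \<rho> * f w \<psi>) = (1 + \<rho> * f' \<zeta> \<psi>) * (x - w)"
    using arg_cong[OF \<zeta>(3), of "\<lambda>y. \<rho> * y"] by (simp add: algebra_simps)
  ultimately show ?thesis by (simp add: abs_mult mult_right_mono)
qed

lemma orbit_invariant:
  assumes "0 \<le> \<rho>" "\<rho> \<le> 1" "x 0 \<in> {\<phi>m..\<phi>M}" "\<And>k. x (Suc k) = x k + \<rho> * f (x k) (\<theta> k)"
  shows "x k \<in> {\<phi>m..\<phi>M}"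
proof (induction k)
  case (Suc k)
  have "\<phi>m + \<rho> * f \<phi>m (\<theta> k) \<le> x (Suc k)" "x (Suc k) \<le> \<phi>M + \<rho> * f \<phi>M (\<theta> k)"
    using Suc assms(4)[of k] step_mono[OF assms(1,2)] by auto
  moreover have "\<rho> * f \<phi>M (\<theta> k) \<le> 0" "0 \<le> \<rho> * f \<phi>m (\<theta> k)"
    using end_pos[of "\<theta> k"] end_neg[of "\<theta> k"] assms(1) by (simp_all add: mult_nonneg_nonpos)
  ultimately show ?case by auto
qed (rule assms)

text \<open>Outside the widened strip the drift points inward with speed at least \<open>e\<close>
  by compactness. The entry time \<tau>, measured in \<open>\<rho> * k\<close>, is uniform in the
  step size and in the sequence of base points.\<close>

lemma orbit_entry:
  assumes "0 < \<epsilon>"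
  obtains \<tau> where "0 \<le> \<tau>"
    "\<And>\<rho> x \<theta> k. 0 \<le> \<rho> \<Longrightarrow> \<rho> \<le> 1 \<Longrightarrow> x 0 \<in> {\<phi>m..\<phi>M} \<Longrightarrow>
       (\<And>k. x (Suc k) = x k + \<rho> * f (x k) (\<theta> k)) \<Longrightarrow> \<tau> \<le> \<rho> * real k \<Longrightarrow> x k \<in> {Sm - \<epsilon>..SM + \<epsilon>}"
proof -
  define a where "a = max \<phi>m (Sm - \<epsilon>)"
  define b where "b = min \<phi>M (SM + \<epsilon>)"
  have "0 < f x \<psi>" if "x \<in> {\<phi>m..a}" for x \<psi>
  proof (cases "x < Sm")
    case False
    then have "x = \<phi>m" using that order assms by (auto simp: a_def max_def split: if_splits)
    then show ?thesis by (simp add: end_pos)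
  qed (use that pos in auto)
  then obtain c where c: "0 < c" "\<And>x \<psi>. x \<in> {\<phi>m..a} \<Longrightarrow> c \<le> f x \<psi>"
    using torus_positive_lower_bound[OF cont per] by metis
  have "0 < - f x \<psi>" if "x \<in> {b..\<phi>M}" for x \<psi>
  proof (cases "x > SM")
    case False
    then have "x = \<phi>M" using that order assms by (auto simp: b_def min_def split: if_splits)
    then show ?thesis by (simp add: end_neg)
  qed (use that neg in auto)
  moreover have "continuous_on ({b..\<phi>M} \<times> UNIV) (\<lambda>(x, \<psi>). - f x \<psi>)"
    using continuous_on_minus[OF cont] by (simp add: case_prod_unfold)
  moreover have "torus_fun (\<lambda>\<psi>. - f x \<psi>)" for x using per by (auto simp: torus_fun_def)
  ultimately obtain d where d: "0 < d" "\<And>x \<psi>. x \<in> {b..\<phi>M} \<Longrightarrow> d \<le> - f x \<psi>"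
    using torus_positive_lower_bound[of b \<phi>M "\<lambda>x \<psi>. - f x \<psi>"] by metis
  define e where "e = min c d"
  define \<tau> where "\<tau> = (\<phi>M - \<phi>m) / e"
  have e: "0 < e" "e \<le> c" "e \<le> d" using c d by (auto simp: e_def)
  show thesis
  proof
    show "0 \<le> \<tau>" using e order by (simp add: \<tau>_def)
    fix \<rho> :: real and x :: "nat \<Rightarrow> real" and \<theta> k
    assume \<rho>: "0 \<le> \<rho>" "\<rho> \<le> 1" and x0: "x 0 \<in> {\<phi>m..\<phi>M}" and x: "\<And>k. x (Suc k) = x k + \<rho> * f (x k) (\<theta> k)"
    \<comment> \<open>Two barriers that move inward at speed \<open>e\<close> until they reach
      \<open>a\<close> and \<open>b\<close>; monotonicity of the step keeps the orbit between
      them.\<close>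
    have "min a (\<phi>m + e * (\<rho> * k)) \<le> x k \<and> x k \<le> max b (\<phi>M - e * (\<rho> * k))" for k
    proof (induction k)
      case 0
      then show ?case using x0 by auto
    next
      case (Suc k)
      let ?l = "min a (\<phi>m + e * (\<rho> * k))" and ?u = "max b (\<phi>M - e * (\<rho> * k))"
      have nn: "0 \<le> e * (\<rho> * k)" using e \<rho> by simp
      have "?l \<in> {\<phi>m..a}" "?u \<in> {b..\<phi>M}" using nn by (auto simp: a_def b_def)
      then have "e \<le> f ?l (\<theta> k)" "e \<le> - f ?u (\<theta> k)" using c(2) d(2) e order_trans by blast+
      from this[THEN mult_left_mono, OF \<rho>(1)]
      have "\<rho> * e \<le> \<rho> * f ?l (\<theta> k)" "\<rho> * e \<le> \<rho> * (- f ?u (\<theta> k))" .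
      moreover have "?l + \<rho> * f ?l (\<theta> k) \<le> x (Suc k)" "x (Suc k) \<le> ?u + \<rho> * f ?u (\<theta> k)"
        unfolding x using Suc step_mono[OF \<rho>] by blast+
      ultimately have "?l + e * \<rho> \<le> x (Suc k)" "x (Suc k) \<le> ?u - e * \<rho>"
        by (simp_all add: mult.commute)
      moreover have "0 \<le> e * \<rho>" using e \<rho> by simp
      moreover have "e * (\<rho> * Suc k) = e * (\<rho> * k) + e * \<rho>" by (simp add: algebra_simps)
      ultimately show ?case by linarith
    qed
    moreover assume "\<tau> \<le> \<rho> * real k"
    then have "\<phi>M - \<phi>m \<le> e * (\<rho> * real k)" using e by (simp add: \<tau>_def field_simps)
    ultimately have "min a \<phi>M \<le> x k" "x k \<le> max b \<phi>m"
      by (smt (verit, best))+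
    then show "x k \<in> {Sm - \<epsilon>..SM + \<epsilon>}"
      using order assms by (auto simp: a_def b_def)
  qed
qed

text \<open>Until the entry time the distance is bounded by the width \<open>D\<close>; afterwards
  both orbits lie where the step contracts at rate \<kappa>.\<close>

lemma graph_attraction:
  assumes "0 < \<kappa>" "\<kappa> < \<gamma>"
  obtains C where "0 \<le> C"
    "\<And>\<rho> x v \<theta> k. 0 \<le> \<rho> \<Longrightarrow> \<rho> \<le> 1 \<Longrightarrow> x 0 \<in> {\<phi>m..\<phi>M} \<Longrightarrow>
       (\<And>k. x (Suc k) = x k + \<rho> * f (x k) (\<theta> k)) \<Longrightarrow>
       (\<And>k. v (Suc k) = v k + \<rho> * f (v k) (\<theta> k)) \<Longrightarrow> (\<And>k. v k \<in> {Sm..SM}) \<Longrightarrow>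
       \<bar>x k - v k\<bar> \<le> C * exp (- (\<kappa> * (\<rho> * real k)))"
proof -
  obtain \<tau> where \<tau>: "0 \<le> \<tau>" 
    "\<And>\<rho> x \<theta> k. 0 \<le> \<rho> \<Longrightarrow> \<rho> \<le> 1 \<Longrightarrow> x 0 \<in> {\<phi>m..\<phi>M} \<Longrightarrow>
       (\<And>k. x (Suc k) = x k + \<rho> * f (x k) (\<theta> k)) \<Longrightarrow> \<tau> \<le> \<rho> * real k \<Longrightarrow>
       x k \<in> {Sm - (\<gamma> - \<kappa>)..SM + (\<gamma> - \<kappa>)}"
    using orbit_entry[of "\<gamma> - \<kappa>"] assms by (metis diff_gt_0_iff_gt)
  define D where "D = \<phi>M - \<phi>m"
  \<comment> \<open>Large enough for the trivial bound \<open>D\<close> to suffice up to time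
    \<open>\<tau> + 1\<close>; the extra 1 covers the step during which \<tau> is passed.\<close>
  define C where "C = D * exp (\<kappa> * (\<tau> + 1))"
  have D: "0 \<le> D" using order by (simp add: D_def)
  show thesis
  proof
    show "0 \<le> C" using D by (simp add: C_def)
    fix \<rho> :: real and x v :: "nat \<Rightarrow> real" and \<theta> k
    assume \<rho>: "0 \<le> \<rho>" "\<rho> \<le> 1" and x0: "x 0 \<in> {\<phi>m..\<phi>M}" 
      and x: "\<And>k. x (Suc k) = x k + \<rho> * f (x k) (\<theta> k)"
      and v: "\<And>k. v (Suc k) = v k + \<rho> * f (v k) (\<theta> k)" and vS: "\<And>k. v k \<in> {Sm..SM}"
    have dist: "\<bar>x k - v k\<bar> \<le> D" for k
      using orbit_invariant[OF \<rho> x0 x, of k] vS[of k] order by (auto simp: D_def)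
    have early: "D \<le> C * exp (- (\<kappa> * s))" if "s \<le> \<tau> + 1" for s
    proof -
      have "1 \<le> exp (\<kappa> * (\<tau> + 1) - \<kappa> * s)" using assms that by simp
      then have "D * 1 \<le> D * exp (\<kappa> * (\<tau> + 1) - \<kappa> * s)" using D by (rule mult_left_mono)
      then show ?thesis by (simp add: C_def exp_diff exp_minus field_simps)
    qed
    show "\<bar>x k - v k\<bar> \<le> C * exp (- (\<kappa> * (\<rho> * real k)))"
    proof (induction k)
      case 0
      show ?case using dist[of 0] early[of 0] \<tau>(1) by simp
    next
      case (Suc k)
      show ?case
      proof (cases "\<tau> \<le> \<rho> * real k")
        case False
        then have "\<rho> * real (Suc k) \<le> \<tau> + 1" using \<rho> by (simp add: algebra_simps)
        then show ?thesis using early dist order_trans by blast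
      next
        case True
        have "\<rho> * \<kappa> \<le> 1"
          using mult_mono[of \<rho> 1 \<kappa> 1] \<rho> assms \<gamma>_le_1 by simp
        have "\<bar>x (Suc k) - v (Suc k)\<bar> \<le> (1 - \<rho> * \<kappa>) * \<bar>x k - v k\<bar>"
          unfolding x v
          using \<tau>(2)[OF \<rho> x0 x True] vS[of k] assms by (intro step_contraction \<rho>) auto
        also have "\<dots> \<le> exp (- (\<rho> * \<kappa>)) * (C * exp (- (\<kappa> * (\<rho> * real k))))"
          using Suc exp_ge_add_one_self[of "- (\<rho> * \<kappa>)"] by (intro mult_mono) auto
        also have "\<dots> = C * exp (- (\<kappa> * (\<rho> * real (Suc k))))"
          by (simp add: algebra_simps flip: exp_add)
        finally show ?thesis .
      qed
    qed
  qed
qed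

text \<open>Linearise at 0: \<open>v\<close> is driven by \<open>f 0\<close> and contracted at rate
  \<gamma>. Subtracting the accumulated forcing leaves \<open>u\<close>, which forgets its initial
  value exponentially, so \<beta> enters with a factor independent of the time span.\<close>

lemma graph_small:
  assumes \<rho>: "0 \<le> \<rho>" "\<rho> \<le> 1"
    and v: "\<And>k. v (Suc k) = v k + \<rho> * f (v k) (\<theta> k)" and vS: "\<And>k. v k \<in> {Sm..SM}"
    and G: "\<And>k. k \<le> n \<Longrightarrow> \<bar>\<rho> * (\<Sum>j<k. f 0 (\<theta> j))\<bar> \<le> \<beta>"
  shows "\<bar>v n\<bar> \<le> 2 * \<beta> + (SM - Sm) * exp (- (\<gamma> * (\<rho> * real n)))"
proof -
  define u where "u k = v k - \<rho> * (\<Sum>j<k. f 0 (\<theta> j))" for k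
  have \<rho>\<gamma>: "\<rho> * \<gamma> \<le> 1" using mult_mono[of \<rho> 1 \<gamma> 1] \<rho> \<gamma>_pos \<gamma>_le_1 by simp
  have "0 \<le> \<beta>" using G[of 0] by simp
  have "\<bar>u k\<bar> - \<beta> \<le> (SM - Sm) * (1 - \<rho> * \<gamma>) ^ k" if "k \<le> n" for k
    using that
  proof (induction k)
    case 0
    then show ?case using vS[of 0] order \<open>0 \<le> \<beta>\<close> by (auto simp: u_def)
  next
    case (Suc k)
    let ?G = "\<rho> * (\<Sum>j<k. f 0 (\<theta> j))"
    obtain \<zeta> where \<zeta>: "min (v k) 0 \<le> \<zeta>" "\<zeta> \<le> max (v k) 0" "f (v k) (\<theta> k) - f 0 (\<theta> k) = f' \<zeta> (\<theta> k) * (v k - 0)"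
      by (rule mean_value)
    define a where "a = \<rho> * (- f' \<zeta> (\<theta> k))"
    have "f' \<zeta> (\<theta> k) \<le> - \<gamma>" using \<zeta>(1,2) vS[of k] order by (intro slope) auto
    then have "\<rho> * \<gamma> \<le> a" unfolding a_def using \<rho>(1) by (intro mult_left_mono) auto
    moreover have "a \<le> \<rho> * 1" unfolding a_def
      using f'_bound[of \<zeta> "\<theta> k"] \<rho>(1) by (intro mult_left_mono) auto
    ultimately have a: "\<rho> * \<gamma> \<le> a" "a \<le> 1" "0 \<le> a" using \<rho> \<gamma>_pos mult_nonneg_nonneg[of \<rho> \<gamma>] by linarith+
    \<comment> \<open>A convex combination of \<open>u k\<close> and \<open>- ?G\<close>, since
      \<open>a\<close> lies between 0 and 1.\<close>
    have "u (Suc k) = (1 - a) * u k - a * ?G"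
      using arg_cong[OF \<zeta>(3), of "\<lambda>y. \<rho> * y"] by (simp add: u_def v a_def algebra_simps)
    then have "\<bar>u (Suc k)\<bar> \<le> (1 - a) * \<bar>u k\<bar> + a * \<bar>?G\<bar>"
      using a abs_triangle_ineq4[of "(1 - a) * u k" "a * ?G"] by (simp only: abs_mult abs_of_nonneg diff_ge_0_iff_ge)
    also have "\<dots> \<le> (1 - a) * \<bar>u k\<bar> + a * \<beta>"
      using G[of k] Suc.prems a by (intro add_left_mono mult_left_mono) auto
    finally have "\<bar>u (Suc k)\<bar> - \<beta> \<le> (1 - a) * (\<bar>u k\<bar> - \<beta>)" by (simp add: algebra_simps)
    \<comment> \<open>The induction hypothesis comes before \<open>1 - a\<close> is enlarged,
      because \<open>\<bar>u k\<bar> - \<beta>\<close> may be negative.\<close>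
    also have "\<dots> \<le> (1 - a) * ((SM - Sm) * (1 - \<rho> * \<gamma>) ^ k)"
      using Suc a by (intro mult_left_mono) auto
    also have "\<dots> \<le> (1 - \<rho> * \<gamma>) * ((SM - Sm) * (1 - \<rho> * \<gamma>) ^ k)"
      using a \<rho>\<gamma> order by (intro mult_right_mono) auto
    finally show ?case by (simp add: algebra_simps)
  qed
  from this[of n] have "\<bar>u n\<bar> \<le> \<beta> + (SM - Sm) * (1 - \<rho> * \<gamma>) ^ n" by simp
  also have "\<dots> \<le> \<beta> + (SM - Sm) * exp (- (\<gamma> * (\<rho> * real n)))"
    using contraction_power_le_exp[of \<rho> \<gamma> n] \<rho> \<rho>\<gamma> \<gamma>_pos order
    by (intro add_left_mono mult_left_mono) auto
  finally show ?thesis using G[of n] by (simp add: u_def)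
qed

text \<open>The increment of \<open>x - u\<close> splits into a Lipschitz term, the fluctuation of
  \<open>f\<close> and the Euler error. The fluctuation is evaluated along \<open>u\<close> rather
  than \<open>x\<close>, so for deterministic \<open>u\<close> the weak law controls it.\<close>

lemma orbit_near_average:
  assumes \<rho>: "0 \<le> \<rho>" and x: "\<And>k. x (Suc k) = x k + \<rho> * f (x k) (\<theta> k)" and "x 0 = u 0"
    and u: "\<And>k. \<bar>u (Suc k) - u k - \<rho> * avg f (u k)\<bar> \<le> \<rho>\<^sup>2"
    and G: "\<And>k. k \<le> n \<Longrightarrow> \<bar>\<rho> * (\<Sum>j<k. f (u j) (\<theta> j) - avg f (u j))\<bar> \<le> \<beta>"
    and "k \<le> n"
  shows "\<bar>x k - u k\<bar> \<le> (\<beta> + \<rho>) * exp (\<rho> * real k)"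
proof (rule discrete_gronwall[where m = n and d = "\<lambda>k. x k - u k"])
  show "0 \<le> \<beta>" using G[of 0] by simp
  fix k assume "k < n"
  have "x (Suc k) - u (Suc k) - (x k - u k)
      - (\<rho> * (\<Sum>j<Suc k. f (u j) (\<theta> j) - avg f (u j)) - \<rho> * (\<Sum>j<k. f (u j) (\<theta> j) - avg f (u j)))
      = \<rho> * (f (x k) (\<theta> k) - f (u k) (\<theta> k)) - (u (Suc k) - u k - \<rho> * avg f (u k))"
    by (simp add: x algebra_simps)
  also have "\<bar>\<dots>\<bar> \<le> \<rho> * \<bar>x k - u k\<bar> + \<rho> * \<rho>"
    using mult_left_mono[OF f_lip[of "x k" "\<theta> k" "u k"] \<rho>] u[of k] \<rho>
      abs_triangle_ineq4[of "\<rho> * (f (x k) (\<theta> k) - f (u k) (\<theta> k))" "u (Suc k) - u k - \<rho> * avg f (u k)"]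
    by (simp add: abs_mult power2_eq_square)
  finally show "\<bar>x (Suc k) - u (Suc k) - (x k - u k)
      - (\<rho> * (\<Sum>j<Suc k. f (u j) (\<theta> j) - avg f (u j)) - \<rho> * (\<Sum>j<k. f (u j) (\<theta> j) - avg f (u j)))\<bar>
      \<le> \<rho> * \<bar>x k - u k\<bar> + \<rho> * \<rho>" .
qed (use assms in auto)

end

section \<open>Averaging on bounded times and conclusion\<close>

lemma skew_map_orbit:
  "fst ((skew_map f A \<rho> ^^ Suc k) (\<phi>, \<psi>)) = fst ((skew_map f A \<rho> ^^ k) (\<phi>, \<psi>))
     + \<rho> * f (fst ((skew_map f A \<rho> ^^ k) (\<phi>, \<psi>))) (((*v) A ^^ k) \<psi>)"
proof -
  have "snd ((skew_map f A \<rho> ^^ k) (\<phi>, \<psi>)) = ((*v) A ^^ k) \<psi>"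
    by (induction k) (simp_all add: skew_map_def case_prod_unfold)
  moreover have "fst (skew_map f A \<rho> p) = fst p + \<rho> * f (fst p) (snd p)" for p
    by (simp add: skew_map_def case_prod_unfold)
  ultimately show ?thesis by simp
qed

lemma invariant_graph_orbit:
  assumes "invariant_graph f A \<rho> I W"
  shows "W (((*v) A ^^ Suc k) \<psi>) = W (((*v) A ^^ k) \<psi>) + \<rho> * f (W (((*v) A ^^ k) \<psi>)) (((*v) A ^^ k) \<psi>)"
    and "W \<psi> \<in> I"
  using assms by (auto simp: invariant_graph_def skew_map_def)

lemma interpolation_bound:
  fixes a b c s M :: real
  assumes "\<bar>a - c\<bar> \<le> M" "\<bar>b - c\<bar> \<le> M" "0 \<le> s" "s \<le> 1"
  shows "\<bar>a + s * (b - a) - c\<bar> \<le> M"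
proof -
  have "a + s * (b - a) - c = (1 - s) * (a - c) + s * (b - c)" by (simp add: algebra_simps)
  also have "\<bar>\<dots>\<bar> \<le> (1 - s) * \<bar>a - c\<bar> + s * \<bar>b - c\<bar>"
    using assms(3,4) abs_triangle_ineq[of "(1 - s) * (a - c)" "s * (b - c)"] by (simp add: abs_mult)
  also have "\<dots> \<le> (1 - s) * M + s * M" using assms by (intro add_mono mult_left_mono) auto
  finally show ?thesis by (simp add: algebra_simps)
qed

text \<open>The centred process interpolates \<open>y\<close> linearly, so estimates at the grid
  times suffice.\<close>

lemma calX_proc_eq:
  assumes "k = nat \<lfloor>t / \<rho>\<rfloor>" "\<And>j. y j = fst ((skew_map f A \<rho> ^^ j) (\<phi>, \<psi>)) - W (((*v) A ^^ j) \<psi>)"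
  shows "calX_proc f A \<rho> W \<phi> t \<psi> = y k + (t / \<rho> - real k) * (y (Suc k) - y k)"
  unfolding calX_proc_def X_proc_def Let_def assms by (simp add: algebra_simps)

lemma nat_floor_divide_bounds:
  assumes "0 < \<rho>" "0 \<le> t"
  shows "\<rho> * real (nat \<lfloor>t / \<rho>\<rfloor>) \<le> t" "t < \<rho> * real (nat \<lfloor>t / \<rho>\<rfloor>) + \<rho>"
    "0 \<le> t / \<rho> - real (nat \<lfloor>t / \<rho>\<rfloor>)" "t / \<rho> - real (nat \<lfloor>t / \<rho>\<rfloor>) \<le> 1"
proof -
  have "real (nat \<lfloor>t / \<rho>\<rfloor>) = of_int \<lfloor>t / \<rho>\<rfloor>" using assms by simp
  then have *: "real (nat \<lfloor>t / \<rho>\<rfloor>) \<le> t / \<rho>" "t / \<rho> < real (nat \<lfloor>t / \<rho>\<rfloor>) + 1" by linarith+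
  show "\<rho> * real (nat \<lfloor>t / \<rho>\<rfloor>) \<le> t" using *(1) assms(1) by (simp add: field_simps)
  show "t < \<rho> * real (nat \<lfloor>t / \<rho>\<rfloor>) + \<rho>" using *(2) assms(1) by (simp add: field_simps)
  show "0 \<le> t / \<rho> - real (nat \<lfloor>t / \<rho>\<rfloor>)" "t / \<rho> - real (nat \<lfloor>t / \<rho>\<rfloor>) \<le> 1" using * by linarith+
qed

section \<open>Comparison with the averaged flow\<close>

context averaging_setting
begin

lemma flow_lip:
  assumes "\<And>t. 0 \<le> t \<Longrightarrow> (\<Phi> has_real_derivative avg f (\<Phi> t)) (at t within {0..})" "0 \<le> s" "0 \<le> t"
  shows "\<bar>\<Phi> t - \<Phi> s\<bar> \<le> \<bar>t - s\<bar>"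
  using field_differentiable_bound[of "{0..}" \<Phi> "\<lambda>t. avg f (\<Phi> t)" 1 t s] assms avg_bound by auto

text \<open>On the step interval the velocity of \<Phi> varies by at most \<rho>, because both
  \<Phi> and the averaged drift are 1-Lipschitz.\<close>

lemma flow_euler_step:
  assumes \<Phi>: "\<And>t. 0 \<le> t \<Longrightarrow> (\<Phi> has_real_derivative avg f (\<Phi> t)) (at t within {0..})" and "0 \<le> t" "0 \<le> \<rho>"
  shows "\<bar>\<Phi> (t + \<rho>) - \<Phi> t - \<rho> * avg f (\<Phi> t)\<bar> \<le> \<rho>\<^sup>2"
proof -
  have "norm ((\<Phi> (t + \<rho>) - (t + \<rho>) * avg f (\<Phi> t)) - (\<Phi> t - t * avg f (\<Phi> t))) \<le> \<rho> * norm (t + \<rho> - t)"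
  proof (rule field_differentiable_bound[where S = "{t..t + \<rho>}" and f' = "\<lambda>s. avg f (\<Phi> s) - avg f (\<Phi> t)"])
    fix s assume s: "s \<in> {t..t + \<rho>}"
    show "((\<lambda>s. \<Phi> s - s * avg f (\<Phi> t)) has_real_derivative avg f (\<Phi> s) - avg f (\<Phi> t)) (at s within {t..t + \<rho>})"
      using s \<open>0 \<le> t\<close> by (auto intro!: derivative_eq_intros DERIV_subset[OF \<Phi>])
    show "norm (avg f (\<Phi> s) - avg f (\<Phi> t)) \<le> \<rho>"
      using avg_lip[of "\<Phi> s" "\<Phi> t"] flow_lip[OF \<Phi>, of t s] s \<open>0 \<le> t\<close> by auto
  qed (use assms in auto)
  then show ?thesis using \<open>0 \<le> \<rho>\<close> by (simp add: algebra_simps power2_eq_square)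
qed

text \<open>The weak law is applied to the forward orbit of \<psi>, with exceptional set
  \<open>E1\<close>, and to the orbit starting \<open>N\<close> steps in the past, with exceptional
  set \<open>E2\<close>. The threshold \<rho>0 is uniform over all invariant graphs.\<close>

lemma finite_time_averaging:
  assumes A: "anosov_automorphism A" and \<phi>: "\<phi> \<in> {\<phi>m..\<phi>M}" and \<Phi>0: "\<Phi> 0 = \<phi>"
    and \<Phi>: "\<And>t. 0 \<le> t \<Longrightarrow> (\<Phi> has_real_derivative avg f (\<Phi> t)) (at t within {0..})"
    and "0 < T" "0 < \<eta>"
  obtains \<rho>0 where "0 < \<rho>0" "\<And>\<rho> W. 0 < \<rho> \<Longrightarrow> \<rho> < \<rho>0 \<Longrightarrow> invariant_graph f A \<rho> {Sm..SM} W \<Longrightarrow>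
    \<exists>E\<in>sets m0. measure m0 E \<le> \<eta> \<and> (\<forall>\<psi>. \<psi> \<notin> E \<longrightarrow> (\<forall>k. \<rho> * real k \<le> T \<longrightarrow>
      \<bar>fst ((skew_map f A \<rho> ^^ k) (\<phi>, \<psi>)) - W (((*v) A ^^ k) \<psi>) - \<Phi> (\<rho> * real k)\<bar> \<le> \<eta>))"
proof -
  obtain B where AB: "A ** B = mat 1" and B: "\<And>i j. B $ i $ j \<in> \<int>"
    using anosov_inverse[OF A] by metis
  have free: "free_family (\<lambda>j \<psi>. ((*v) A ^^ j) (((*v) B ^^ N) \<psi>))" for N
    by (rule anosov_free_family[OF A AB B])
  define D where "D = SM - Sm"
  \<comment> \<open>The time after which an initial error \<open>D\<close> on the graph has decayed
    to \<open>\<eta> / 4\<close>; linear growth of the exponential is enough here.\<close>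
  define T' where "T' = 4 * D / (\<gamma> * \<eta>)"
  have D: "0 \<le> D" using order by (simp add: D_def)
  then have T': "0 \<le> T'" using \<gamma>_pos \<open>0 < \<eta>\<close> by (simp add: T'_def)
  have tail: "D * exp (- (\<gamma> * s)) \<le> \<eta> / 4" if "T' \<le> s" for s
  proof -
    have "4 * D / \<eta> = \<gamma> * T'" using \<gamma>_pos \<open>0 < \<eta>\<close> by (simp add: T'_def)
    also have "\<dots> \<le> \<gamma> * s" using that \<gamma>_pos by simp
    also have "\<dots> \<le> exp (\<gamma> * s)" using exp_ge_add_one_self[of "\<gamma> * s"] by linarith
    finally show ?thesis using \<open>0 < \<eta>\<close> by (simp add: exp_minus field_simps)
  qed
  \<comment> \<open>\<open>K\<close> bounds the rescaled lengths of both sums, rounding included.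
    \<eta>1 is so small that \<open>\<eta>1 * K\<close> stays below \<open>\<eta> / 8\<close> even
    after the Gronwall factor \<open>exp T\<close>.\<close>
  define K where "K = T + T' + 4"
  define \<eta>1 where "\<eta>1 = \<eta> / (8 * K * exp T)"
  have K: "4 \<le> K" using T' \<open>0 < T\<close> by (simp add: K_def)
  have eT: "1 \<le> exp T" using \<open>0 < T\<close> by simp
  have \<eta>1: "0 < \<eta>1" "\<eta>1 * K * exp T = \<eta> / 8" using K \<open>0 < \<eta>\<close> by (simp_all add: \<eta>1_def)
  have \<eta>1K: "\<eta>1 * K \<le> \<eta> / 8"
    using mult_left_mono[OF eT, of "\<eta>1 * K"] \<eta>1 K by simp
  have \<eta>12: "2 * \<eta>1 \<le> \<eta>"
    using mult_left_mono[OF K, of \<eta>1] \<eta>1(1) \<eta>1K \<open>0 < \<eta>\<close> by linarith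
  define R where "R = \<bar>\<phi>\<bar> + K"
  obtain n0 where n0: "\<And>n F z. n \<ge> n0 \<Longrightarrow> free_family F \<Longrightarrow> \<forall>j<n. \<bar>z j\<bar> \<le> R \<Longrightarrow>
     \<exists>E\<in>sets m0. measure m0 E \<le> \<eta>1 \<and>
       (\<forall>\<psi>. \<psi> \<notin> E \<longrightarrow> (\<forall>k\<le>n. \<bar>\<Sum>j<k. f (z j) (F j \<psi>) - avg f (z j)\<bar> \<le> \<eta>1 * real n))"
    by (rule maximal_weak_law[OF cont per f_bound \<eta>1(1), of R]) blast
  \<comment> \<open>The second bound keeps the Euler error after Gronwall below
    \<open>\<eta> / 4\<close>; the third makes the number of steps at least
    \<open>n0\<close>.\<close>
  define \<rho>0 where "\<rho>0 = min 1 (min (\<eta> / (4 * exp T)) (T / (real n0 + 1)))"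
  show thesis
  proof
    show "0 < \<rho>0" using \<open>0 < \<eta>\<close> \<open>0 < T\<close> by (simp add: \<rho>0_def)
    fix \<rho> W assume \<rho>: "0 < \<rho>" "\<rho> < \<rho>0" and W: "invariant_graph f A \<rho> {Sm..SM} W"
    have \<rho>1: "\<rho> \<le> 1" and \<rho>2: "\<rho> * exp T \<le> \<eta> / 4" and \<rho>3: "real n0 \<le> T / \<rho>"
      using \<rho> \<open>0 < T\<close> by (auto simp: \<rho>0_def field_simps)
    define n where "n = Suc (nat \<lceil>T / \<rho>\<rceil>)"
    define N where "N = nat \<lceil>T' / \<rho>\<rceil>"
    have T\<rho>: "0 \<le> T / \<rho>" "0 \<le> T' / \<rho>" using \<rho> T' \<open>0 < T\<close> by auto
    then have n: "T / \<rho> \<le> real n" "real n \<le> T / \<rho> + 2" and N: "T' / \<rho> \<le> real N" "real N \<le> T' / \<rho> + 1"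
      unfolding n_def N_def by linarith+
    have \<rho>n: "\<rho> * real n \<le> T + 2" and \<rho>N: "T' \<le> \<rho> * real N" "\<rho> * real N \<le> T' + 1"
      using mult_left_mono[OF n(2), of \<rho>] mult_left_mono[OF N(1), of \<rho>] mult_left_mono[OF N(2), of \<rho>] \<rho> \<rho>1
      by (simp_all add: algebra_simps)
    have nn0: "n0 \<le> n" "n0 \<le> N + n" using \<rho>3 n(1) by linarith+
    define u where "u j = \<Phi> (\<rho> * real j)" for j
    have uR: "\<bar>u j\<bar> \<le> R" if "j < n" for j
    proof -
      have "\<rho> * real j \<le> \<rho> * real n" using that \<rho> by (intro mult_left_mono) auto
      moreover have "\<bar>u j - \<phi>\<bar> \<le> \<rho> * real j"
        using flow_lip[OF \<Phi>, of 0 "\<rho> * real j"] \<rho> by (simp add: u_def \<Phi>0)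
      ultimately show ?thesis using \<rho>n T' by (simp add: R_def K_def)
    qed
    obtain E1 where E1: "E1 \<in> sets m0" "measure m0 E1 \<le> \<eta>1"
      "\<And>\<psi> k. \<psi> \<notin> E1 \<Longrightarrow> k \<le> n \<Longrightarrow> \<bar>\<Sum>j<k. f (u j) (((*v) A ^^ j) \<psi>) - avg f (u j)\<bar> \<le> \<eta>1 * real n"
      using n0[OF nn0(1) free[of 0], of u] uR by auto
    \<comment> \<open>At \<open>z = 0\<close> the average vanishes, so the centred sums are the bare
      sums required by \<open>graph_small\<close>.\<close>
    obtain E2 where E2: "E2 \<in> sets m0" "measure m0 E2 \<le> \<eta>1"
      "\<And>\<psi> k. \<psi> \<notin> E2 \<Longrightarrow> k \<le> N + n \<Longrightarrow>
         \<bar>\<Sum>j<k. f 0 (((*v) A ^^ j) (((*v) B ^^ N) \<psi>))\<bar> \<le> \<eta>1 * real (N + n)"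
      using n0[OF nn0(2) free[of N], of "\<lambda>_. 0"] K by (auto simp: R_def avg_0)
    have "\<bar>fst ((skew_map f A \<rho> ^^ k) (\<phi>, \<psi>)) - W (((*v) A ^^ k) \<psi>) - \<Phi> (\<rho> * real k)\<bar> \<le> \<eta>"
      if \<psi>: "\<psi> \<notin> E1 \<union> E2" and k: "\<rho> * real k \<le> T" for \<psi> k
    proof -
      have "real k \<le> T / \<rho>" using k \<rho> by (simp add: field_simps)
      then have kn: "k \<le> n" using n(1) by linarith
      have x: "\<bar>fst ((skew_map f A \<rho> ^^ k) (\<phi>, \<psi>)) - u k\<bar> \<le> (\<eta>1 * (T + 2) + \<rho>) * exp (\<rho> * real k)"
      proof (rule orbit_near_average[where \<theta> = "\<lambda>j. ((*v) A ^^ j) \<psi>" and n = n])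
        show "\<bar>u (Suc k) - u k - \<rho> * avg f (u k)\<bar> \<le> \<rho>\<^sup>2" for k
          using flow_euler_step[OF \<Phi>, of "\<rho> * real k" \<rho>] \<rho> by (simp add: u_def algebra_simps)
        show "\<bar>\<rho> * (\<Sum>j<k. f (u j) (((*v) A ^^ j) \<psi>) - avg f (u j))\<bar> \<le> \<eta>1 * (T + 2)" if "k \<le> n" for k
        proof -
          have "\<bar>\<rho> * (\<Sum>j<k. f (u j) (((*v) A ^^ j) \<psi>) - avg f (u j))\<bar> \<le> \<rho> * (\<eta>1 * real n)"
            using E1(3)[of \<psi> k] \<psi> that \<rho> by (simp add: abs_mult)
          also have "\<dots> \<le> \<eta>1 * (T + 2)"
            using mult_left_mono[OF \<rho>n, of \<eta>1] \<eta>1(1) by (simp add: mult_ac)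
          finally show ?thesis .
        qed
      qed (use \<rho> kn in \<open>simp_all add: u_def \<Phi>0 skew_map_orbit del: funpow.simps(2)\<close>)
      also have "\<dots> \<le> (\<eta>1 * K + \<rho>) * exp T"
        using k \<eta>1(1) \<rho> T' \<open>0 < T\<close> by (intro mult_mono add_mono mult_left_mono) (auto simp: K_def)
      also have "\<dots> \<le> \<eta> / 8 + \<eta> / 4" using \<eta>1(2) \<rho>2 by (simp add: algebra_simps)
      finally have x: "\<bar>fst ((skew_map f A \<rho> ^^ k) (\<phi>, \<psi>)) - u k\<bar> \<le> \<eta> / 8 + \<eta> / 4" .
      \<comment> \<open>The graph over the orbit from the \<open>N\<close>-fold preimage of \<psi>;
        after \<open>N\<close> steps it passes through \<open>W \<psi>\<close>, with the initial
        value already forgotten.\<close>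
      define v where "v j = W (((*v) A ^^ j) (((*v) B ^^ N) \<psi>))" for j
      have AB': "A *v (B *v y) = y" for y by (simp add: matrix_vector_mul_assoc AB)
      have "v (N + k) = W (((*v) A ^^ k) \<psi>)"
        by (simp add: v_def add.commute[of N k] funpow_add funpow_cancel[where f = "(*v) A" and g = "(*v) B", OF AB'])
      moreover have "\<bar>v (N + k)\<bar> \<le> 2 * (\<eta>1 * K) + (SM - Sm) * exp (- (\<gamma> * (\<rho> * real (N + k))))"
      proof (rule graph_small[where \<theta> = "\<lambda>j. ((*v) A ^^ j) (((*v) B ^^ N) \<psi>)"])
        show "v (Suc j) = v j + \<rho> * f (v j) (((*v) A ^^ j) (((*v) B ^^ N) \<psi>))" for j
          unfolding v_def by (rule invariant_graph_orbit[OF W])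
        show "v j \<in> {Sm..SM}" for j unfolding v_def by (rule invariant_graph_orbit[OF W])
        show "\<bar>\<rho> * (\<Sum>j<i. f 0 (((*v) A ^^ j) (((*v) B ^^ N) \<psi>)))\<bar> \<le> \<eta>1 * K" if "i \<le> N + k" for i
        proof -
          have "\<bar>\<rho> * (\<Sum>j<i. f 0 (((*v) A ^^ j) (((*v) B ^^ N) \<psi>)))\<bar> \<le> \<rho> * (\<eta>1 * real (N + n))"
            using E2(3)[of \<psi> i] \<psi> that kn \<rho> by (simp add: abs_mult)
          also have "\<dots> = \<eta>1 * (\<rho> * real N + \<rho> * real n)" by (simp add: algebra_simps)
          also have "\<dots> \<le> \<eta>1 * K"
            using \<rho>n \<rho>N(2) \<eta>1(1) by (intro mult_left_mono) (auto simp: K_def)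
          finally show ?thesis .
        qed
      qed (use \<rho> \<rho>1 in auto)
      moreover have "(SM - Sm) * exp (- (\<gamma> * (\<rho> * real (N + k)))) \<le> \<eta> / 4"
        unfolding D_def[symmetric] using \<rho>N(1) \<rho> by (intro tail) (simp add: algebra_simps add_increasing2)
      ultimately have "\<bar>W (((*v) A ^^ k) \<psi>)\<bar> \<le> \<eta> / 4 + \<eta> / 4" using \<eta>1K by linarith
      then show ?thesis using x \<open>0 < \<eta>\<close> unfolding u_def by linarith
    qed
    moreover have "measure m0 (E1 \<union> E2) \<le> \<eta>"
      using measure_Un_le[OF E1(1) E2(1)] E1(2) E2(2) \<eta>12 by linarith
    ultimately show "\<exists>E\<in>sets m0. measure m0 E \<le> \<eta> \<and> (\<forall>\<psi>. \<psi> \<notin> E \<longrightarrow> (\<forall>k. \<rho> * real k \<le> T \<longrightarrow>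
      \<bar>fst ((skew_map f A \<rho> ^^ k) (\<phi>, \<psi>)) - W (((*v) A ^^ k) \<psi>) - \<Phi> (\<rho> * real k)\<bar> \<le> \<eta>))"
      using E1(1) E2(1) by (intro bexI[of _ "E1 \<union> E2"]) auto
  qed
qed

text \<open>A rate \<kappa> strictly between \<xi> and \<gamma> leaves room to make the weighted
  difference small after a fixed time \<open>T\<close>; before \<open>T\<close> the weight is
  bounded and finite-time averaging applies.\<close>

lemma exponential_convergence:
  assumes A: "anosov_automorphism A" and \<phi>: "\<phi> \<in> {\<phi>m..\<phi>M}" and \<Phi>0: "\<Phi> 0 = \<phi>"
    and \<Phi>: "\<And>t. 0 \<le> t \<Longrightarrow> (\<Phi> has_real_derivative avg f (\<Phi> t)) (at t within {0..})"
    and W: "\<forall>\<^sub>F \<rho> in at_right 0. invariant_graph f A \<rho> {Sm..SM} (W \<rho>)"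
    and \<xi>: "0 \<le> \<xi>" "\<xi> < \<gamma>" and "0 < \<delta>"
  shows "((\<lambda>\<rho>. measure m0 {\<psi> \<in> space m0.
            exp_norm \<xi> (\<lambda>t. calX_proc f A \<rho> (W \<rho>) \<phi> t \<psi> - \<Phi> t) > ereal \<delta>})
          \<longlongrightarrow> 0) (at_right 0)"
proof -
  define y where "y \<rho> \<psi> k = fst ((skew_map f A \<rho> ^^ k) (\<phi>, \<psi>)) - W \<rho> (((*v) A ^^ k) \<psi>)" for \<rho> \<psi> k
  obtain b where b: "0 < b" "\<And>\<rho>. 0 < \<rho> \<Longrightarrow> \<rho> < b \<Longrightarrow> invariant_graph f A \<rho> {Sm..SM} (W \<rho>)"
    using W unfolding eventually_at_right_field by auto
  define \<kappa> where "\<kappa> = (\<xi> + \<gamma>) / 2"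
  have \<kappa>: "0 < \<kappa>" "\<kappa> < \<gamma>" "\<xi> < \<kappa>" using \<xi> \<gamma>_pos by (auto simp: \<kappa>_def)
  obtain C where C: "0 \<le> C"
    "\<And>\<rho> x v \<theta> k. 0 \<le> \<rho> \<Longrightarrow> \<rho> \<le> 1 \<Longrightarrow> x 0 \<in> {\<phi>m..\<phi>M} \<Longrightarrow>
       (\<And>k. x (Suc k) = x k + \<rho> * f (x k) (\<theta> k)) \<Longrightarrow>
       (\<And>k. v (Suc k) = v k + \<rho> * f (v k) (\<theta> k)) \<Longrightarrow> (\<And>k. v k \<in> {Sm..SM}) \<Longrightarrow>
       \<bar>x k - v k\<bar> \<le> C * exp (- (\<kappa> * (\<rho> * real k)))"
    using graph_attraction[OF \<kappa>(1,2)] by metis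
  \<comment> \<open>The factor \<open>exp \<kappa>\<close> absorbs that \<open>t\<close> may exceed
    the grid time by one step.\<close>
  define C2 where "C2 = C * exp \<kappa>"
  have C2: "0 \<le> C2" using C(1) by (simp add: C2_def)
  have y_decay: "\<bar>y \<rho> \<psi> k\<bar> \<le> C2 * exp (- (\<kappa> * t))"
    if \<rho>: "0 < \<rho>" "\<rho> < b" "\<rho> \<le> 1" and t: "t \<le> \<rho> * real k + \<rho>" for \<rho> \<psi> k t
  proof -
    note graph = invariant_graph_orbit[OF b(2)[OF \<rho>(1,2)]]
    have "\<bar>y \<rho> \<psi> k\<bar> \<le> C * exp (- (\<kappa> * (\<rho> * real k)))"
      unfolding y_def
    proof (rule C(2)[where \<theta> = "\<lambda>k. ((*v) A ^^ k) \<psi>"])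
      show "fst ((skew_map f A \<rho> ^^ Suc k) (\<phi>, \<psi>)) = fst ((skew_map f A \<rho> ^^ k) (\<phi>, \<psi>))
          + \<rho> * f (fst ((skew_map f A \<rho> ^^ k) (\<phi>, \<psi>))) (((*v) A ^^ k) \<psi>)" for k
        by (rule skew_map_orbit)
    qed (use \<rho> \<phi> graph in \<open>auto simp del: funpow.simps(2) atLeastAtMost_iff\<close>)
    also have "\<dots> \<le> C * exp (\<kappa> + - (\<kappa> * t))"
    proof -
      have "\<kappa> * t \<le> \<kappa> * (\<rho> * real k + 1)" using t \<rho> \<kappa> by (intro mult_left_mono) auto
      then show ?thesis using C(1) by (intro mult_left_mono) (auto simp: algebra_simps)
    qed
    finally show ?thesis unfolding C2_def exp_add mult.assoc .
  qed
  \<comment> \<open>A deterministic bound extracted from one good point: the exceptional set has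
    measure at most 1/2, so some \<psi> lies outside it, and its decaying orbit is within
    \<open>e\<close> of \<open>\<Phi> t\<close>.\<close>
  have \<Phi>_decay: "\<bar>\<Phi> t\<bar> \<le> C2 * exp (- (\<kappa> * t))" if t: "0 \<le> t" for t
  proof (rule field_le_epsilon)
    fix e :: real assume "0 < e"
    define \<eta> where "\<eta> = min (e / 2) (1 / 2)"
    obtain \<rho>0 where \<rho>0: "0 < \<rho>0" "\<And>\<rho> W. 0 < \<rho> \<Longrightarrow> \<rho> < \<rho>0 \<Longrightarrow> invariant_graph f A \<rho> {Sm..SM} W \<Longrightarrow>
    \<exists>E\<in>sets m0. measure m0 E \<le> \<eta> \<and> (\<forall>\<psi>. \<psi> \<notin> E \<longrightarrow> (\<forall>k. \<rho> * real k \<le> t + 1 \<longrightarrow>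
      \<bar>fst ((skew_map f A \<rho> ^^ k) (\<phi>, \<psi>)) - W (((*v) A ^^ k) \<psi>) - \<Phi> (\<rho> * real k)\<bar> \<le> \<eta>))"
      using finite_time_averaging[OF A \<phi> \<Phi>0 \<Phi>, of "t + 1" \<eta>] t \<open>0 < e\<close> by (auto simp: \<eta>_def)
    define \<rho> where "\<rho> = min (min \<rho>0 b) (min 1 e) / 2"
    have \<rho>: "0 < \<rho>" "\<rho> < \<rho>0" "\<rho> < b" "\<rho> \<le> 1" "\<rho> \<le> e / 2"
      using \<rho>0(1) b(1) \<open>0 < e\<close> by (auto simp: \<rho>_def)
    define k where "k = nat \<lfloor>t / \<rho>\<rfloor>"
    have k: "\<rho> * real k \<le> t" "t < \<rho> * real k + \<rho>"
      using nat_floor_divide_bounds[OF \<rho>(1) t] by (simp_all add: k_def)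
    obtain E where E: "E \<in> sets m0" "measure m0 E \<le> \<eta>"
      "\<And>\<psi>. \<psi> \<notin> E \<Longrightarrow> \<bar>y \<rho> \<psi> k - \<Phi> (\<rho> * real k)\<bar> \<le> \<eta>"
      using \<rho>0(2)[OF \<rho>(1,2) b(2)[OF \<rho>(1,3)]] k unfolding y_def by force
    have "E \<noteq> UNIV" using E(2) by (auto simp: \<eta>_def)
    then obtain \<psi> where "\<psi> \<notin> E" by auto
    have "\<eta> \<le> e / 2" by (simp add: \<eta>_def)
    then have "\<bar>\<Phi> (\<rho> * real k)\<bar> \<le> \<bar>y \<rho> \<psi> k\<bar> + e / 2" using E(3)[OF \<open>\<psi> \<notin> E\<close>] by linarith
    also have "\<bar>y \<rho> \<psi> k\<bar> \<le> C2 * exp (- (\<kappa> * t))" using y_decay[OF \<rho>(1,3,4)] k by simp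
    finally show "\<bar>\<Phi> t\<bar> \<le> C2 * exp (- (\<kappa> * t)) + e"
      using flow_lip[OF \<Phi>, of "\<rho> * real k" t] k \<rho> t by auto
  qed
  define g where "g = \<kappa> - \<xi>"
  have g: "0 < g" using \<kappa> by (simp add: g_def)
  \<comment> \<open>Chosen so that \<open>\<delta> * (g * T)\<close> is at least
    \<open>2 * C2\<close>, the combined constant of the process and \<Phi>. The added 1 keeps
    \<open>T\<close> positive when \<open>C2 = 0\<close>.\<close>
  define T where "T = 2 * C2 / (\<delta> * g) + 1"
  have T: "0 < T" using C2 g \<open>0 < \<delta>\<close> by (simp add: T_def add_nonneg_pos)
  have late: "exp (\<xi> * t) * (2 * C2 * exp (- (\<kappa> * t))) \<le> \<delta>" if "T \<le> t" for t
  proof -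
    have "2 * C2 / \<delta> \<le> g * T" using g \<open>0 < \<delta>\<close> by (simp add: T_def field_simps)
    also have "\<dots> \<le> g * t" using that g by simp
    also have "\<dots> \<le> exp (g * t)" using exp_ge_add_one_self[of "g * t"] by linarith
    finally show ?thesis
      using \<open>0 < \<delta>\<close> by (simp add: g_def left_diff_distrib exp_diff exp_minus field_simps)
  qed
  show ?thesis
  proof (rule tendstoI)
    fix r :: real assume "0 < r"
    \<comment> \<open>One \<open>d\<close> pays for the averaging error, the other for moving \<Phi>
      from a grid time to \<open>t\<close>; the weight is at most
      \<open>exp (\<xi> * T)\<close>.\<close>
    define d where "d = \<delta> / (2 * exp (\<xi> * T))"
    have d: "0 < d" "exp (\<xi> * T) * (d + d) = \<delta>" using \<open>0 < \<delta>\<close> by (simp_all add: d_def)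
    define \<eta> where "\<eta> = min (r / 2) d"
    have \<eta>: "0 < \<eta>" "\<eta> < r" "\<eta> \<le> d" using \<open>0 < r\<close> d by (auto simp: \<eta>_def)
    \<comment> \<open>The horizon \<open>T + 1\<close> includes the right grid neighbour of every
      \<open>t \<le> T\<close>.\<close>
    obtain \<rho>0 where \<rho>0: "0 < \<rho>0" "\<And>\<rho> W. 0 < \<rho> \<Longrightarrow> \<rho> < \<rho>0 \<Longrightarrow> invariant_graph f A \<rho> {Sm..SM} W \<Longrightarrow>
    \<exists>E\<in>sets m0. measure m0 E \<le> \<eta> \<and> (\<forall>\<psi>. \<psi> \<notin> E \<longrightarrow> (\<forall>k. \<rho> * real k \<le> T + 1 \<longrightarrow>
      \<bar>fst ((skew_map f A \<rho> ^^ k) (\<phi>, \<psi>)) - W (((*v) A ^^ k) \<psi>) - \<Phi> (\<rho> * real k)\<bar> \<le> \<eta>))"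
      using finite_time_averaging[OF A \<phi> \<Phi>0 \<Phi>, of "T + 1" \<eta>] T \<eta> by auto
    have "measure m0 {\<psi> \<in> space m0. exp_norm \<xi> (\<lambda>t. calX_proc f A \<rho> (W \<rho>) \<phi> t \<psi> - \<Phi> t) > ereal \<delta>} < r"
      if \<rho>: "0 < \<rho>" "\<rho> < min (min \<rho>0 b) (min 1 d)" for \<rho>
    proof -
      have \<rho>': "\<rho> < \<rho>0" "\<rho> < b" "\<rho> \<le> 1" "\<rho> \<le> d" using \<rho> by auto
      obtain E where E: "E \<in> sets m0" "measure m0 E \<le> \<eta>"
        "\<And>\<psi> k. \<psi> \<notin> E \<Longrightarrow> \<rho> * real k \<le> T + 1 \<Longrightarrow> \<bar>y \<rho> \<psi> k - \<Phi> (\<rho> * real k)\<bar> \<le> \<eta>"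
        using \<rho>0(2)[OF \<rho>(1) \<rho>'(1) b(2)[OF \<rho>(1) \<rho>'(2)]] unfolding y_def by auto
      have "exp_norm \<xi> (\<lambda>t. calX_proc f A \<rho> (W \<rho>) \<phi> t \<psi> - \<Phi> t) \<le> ereal \<delta>" if \<psi>: "\<psi> \<notin> E" for \<psi>
        unfolding exp_norm_def
      proof (rule SUP_least, unfold ereal_less_eq)
        fix t :: real assume "t \<in> {0..}"
        then have t: "0 \<le> t" by simp
        define k where "k = nat \<lfloor>t / \<rho>\<rfloor>"
        note k = nat_floor_divide_bounds[OF \<rho>(1) t, folded k_def]
        have X: "calX_proc f A \<rho> (W \<rho>) \<phi> t \<psi> = y \<rho> \<psi> k + (t / \<rho> - real k) * (y \<rho> \<psi> (Suc k) - y \<rho> \<psi> k)"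
          by (rule calX_proc_eq) (simp_all only: k_def y_def)
        show "exp (\<xi> * t) * \<bar>calX_proc f A \<rho> (W \<rho>) \<phi> t \<psi> - \<Phi> t\<bar> \<le> \<delta>"
        proof (cases "t \<le> T")
          case True
          have near: "\<bar>y \<rho> \<psi> j - \<Phi> t\<bar> \<le> d + d" if "\<rho> * real j \<le> T + 1" "\<bar>t - \<rho> * real j\<bar> \<le> \<rho>" for j
            using E(3)[OF \<psi> that(1)] flow_lip[OF \<Phi>, of "\<rho> * real j" t] \<rho> t \<eta> \<rho>'(4) that(2) by auto
          have "\<bar>calX_proc f A \<rho> (W \<rho>) \<phi> t \<psi> - \<Phi> t\<bar> \<le> d + d"
            unfolding X using k True \<rho>' \<rho>(1)
            by (intro interpolation_bound near) (auto simp: algebra_simps)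
          moreover have "exp (\<xi> * t) \<le> exp (\<xi> * T)" using True \<xi> by (simp add: mult_left_mono)
          ultimately have "exp (\<xi> * t) * \<bar>calX_proc f A \<rho> (W \<rho>) \<phi> t \<psi> - \<Phi> t\<bar> \<le> exp (\<xi> * T) * (d + d)"
            by (intro mult_mono) auto
          then show ?thesis by (simp only: d)
        next
          case False
          have "\<bar>y \<rho> \<psi> k + (t / \<rho> - real k) * (y \<rho> \<psi> (Suc k) - y \<rho> \<psi> k) - 0\<bar> \<le> C2 * exp (- (\<kappa> * t))"
            using k \<rho>(1) by (intro interpolation_bound) (auto intro!: y_decay[OF \<rho>(1) \<rho>'(2,3)] simp: algebra_simps)
          moreover have "\<bar>q - p\<bar> \<le> 2 * c" if "\<bar>q - 0\<bar> \<le> c" "\<bar>p\<bar> \<le> c" for p q c :: real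
            using that by linarith
          ultimately have "\<bar>calX_proc f A \<rho> (W \<rho>) \<phi> t \<psi> - \<Phi> t\<bar> \<le> 2 * C2 * exp (- (\<kappa> * t))"
            using \<Phi>_decay[OF t] unfolding X mult.assoc by blast
          then have "exp (\<xi> * t) * \<bar>calX_proc f A \<rho> (W \<rho>) \<phi> t \<psi> - \<Phi> t\<bar> \<le> exp (\<xi> * t) * (2 * C2 * exp (- (\<kappa> * t)))"
            by (intro mult_left_mono) auto
          also have "\<dots> \<le> \<delta>" using False by (intro late) simp
          finally show ?thesis .
        qed
      qed
      then have "{\<psi> \<in> space m0. exp_norm \<xi> (\<lambda>t. calX_proc f A \<rho> (W \<rho>) \<phi> t \<psi> - \<Phi> t) > ereal \<delta>} \<subseteq> E"
        by (auto simp: not_less[symmetric])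
      \<comment> \<open>Monotonicity asks for measurability of the larger set \<open>E\<close> only,
        so the supremum over uncountably many times needs no separate treatment.\<close>
      then have "measure m0 {\<psi> \<in> space m0. exp_norm \<xi> (\<lambda>t. calX_proc f A \<rho> (W \<rho>) \<phi> t \<psi> - \<Phi> t) > ereal \<delta>}
          \<le> measure m0 E"
        using E(1) by (rule m0.finite_measure_mono)
      then show ?thesis using E(2) \<eta> by linarith
    qed
    moreover have "0 < min (min \<rho>0 b) (min 1 d)" using \<rho>0(1) b(1) d by simp
    ultimately show "\<forall>\<^sub>F \<rho> in at_right 0. dist (measure m0 {\<psi> \<in> space m0.
            exp_norm \<xi> (\<lambda>t. calX_proc f A \<rho> (W \<rho>) \<phi> t \<psi> - \<Phi> t) > ereal \<delta>}) 0 < r"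
      unfolding eventually_at_right_field by (auto intro!: exI[of _ "min (min \<rho>0 b) (min 1 d)"])
  qed
qed

end

section \<open>Verification of the dynamical setting for functions in the Hoelder space\<close>

theorem theorem8:
  fixes f :: "real \<Rightarrow> real^2 \<Rightarrow> real" and A :: "real^2^2"
    and \<alpha>0 \<phi>m \<phi>M Sm SM \<gamma> \<phi> \<xi> \<delta> :: real
    and S :: "real^2 \<Rightarrow> real" and W :: "real \<Rightarrow> real^2 \<Rightarrow> real" and \<Phi> :: "real \<Rightarrow> real"
  assumes "anosov_automorphism A"
    and "0 < \<alpha>0" "\<alpha>0 \<le> 1"
    and "f \<in> B_space \<alpha>0 6" "B_norm \<alpha>0 6 f = 1"
    and "\<phi>m < \<phi>M" "\<phi>M - \<phi>m < 2 * pi"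
    and "\<And>\<psi>. f \<phi>m \<psi> > 0" "\<And>\<psi>. f \<phi>M \<psi> < 0"
    and "\<And>\<psi>. S \<psi> \<in> {\<phi>m<..<\<phi>M} \<and> f (S \<psi>) \<psi> = 0"
    and "\<And>\<psi> s. s \<in> {\<phi>m<..<\<phi>M} \<Longrightarrow> f s \<psi> = 0 \<Longrightarrow> s = S \<psi>"
    and "Sm = (INF \<psi>. S \<psi>)" "SM = (SUP \<psi>. S \<psi>)"
    and "\<gamma> = - (SUP (x, \<psi>)\<in>{Sm..SM} \<times> UNIV. dphi 1 f x \<psi>)" "\<gamma> > 0"
    and "0 \<in> {Sm..SM}" "avg f 0 = 0"
    and "\<And>x. x \<in> {\<phi>m..\<phi>M} \<Longrightarrow> avg f x = 0 \<Longrightarrow> x = 0"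
    and "\<forall>\<^sub>F \<rho> in at_right 0. invariant_graph f A \<rho> {Sm..SM} (W \<rho>)"
    and "\<phi> \<in> {\<phi>m..\<phi>M}"
    and "\<Phi> 0 = \<phi>"
    and "\<And>t. t \<ge> 0 \<Longrightarrow> (\<Phi> has_real_derivative avg f (\<Phi> t)) (at t within {0..})"
    and "0 \<le> \<xi>" "\<xi> < \<gamma>"
    and "\<delta> > 0"
  shows "((\<lambda>\<rho>. measure m0 {\<psi> \<in> space m0.
            exp_norm \<xi> (\<lambda>t. calX_proc f A \<rho> (W \<rho>) \<phi> t \<psi> - \<Phi> t) > ereal \<delta>})
          \<longlongrightarrow> 0) (at_right 0)"
proof -
  note f = assms(4) and norm1 = assms(5) and S = assms(10) and uniq = assms(11)
  have deriv: "((\<lambda>x. dphi n f x \<psi>) has_real_derivative dphi (Suc n) f x \<psi>) (at x)" if "n < 6" for n x \<psi>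
    by (rule B_space_dphi_deriv[OF f that])
  have bound: "\<bar>dphi n f x \<psi>\<bar> \<le> 1" if "n \<le> 6" for n x \<psi>
    by (rule B_norm_abs_dphi_le[OF norm1 that])
  have lip: "\<bar>dphi n f x \<psi> - dphi n f y \<psi>\<bar> \<le> \<bar>x - y\<bar>" if "n < 6" for n x y \<psi>
    using field_differentiable_bound[of UNIV "\<lambda>x. dphi n f x \<psi>" "\<lambda>x. dphi (Suc n) f x \<psi>" 1 x y]
      deriv[OF that] bound[of "Suc n"] that by auto
  have cont: "continuous_on U (\<lambda>(x, \<psi>). f x \<psi>)" for U
    using lip[of 0] B_norm_holder[OF norm1 _ \<open>0 < \<alpha>0\<close>] \<open>0 < \<alpha>0\<close>
    by (intro continuous_on_lipschitz_holder[of f \<alpha>0]) auto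
  have bdd: "bdd_below (range S)" "bdd_above (range S)"
    using S by (auto intro!: bdd_belowI[of _ \<phi>m] bdd_aboveI[of _ \<phi>M] less_imp_le)
  have S_bounds: "Sm \<le> S \<psi>" "S \<psi> \<le> SM" for \<psi>
    unfolding assms(12,13) using bdd by (auto intro: cINF_lower cSUP_upper)
  have contx: "continuous_on U (\<lambda>x. f x \<psi>)" for U \<psi>
    by (rule continuous_on_compose2[OF cont[of UNIV], of _ "\<lambda>x. (x, \<psi>)", simplified]) (intro continuous_intros)
  interpret averaging_setting f "dphi 1 f" \<phi>m \<phi>M Sm SM \<gamma>
  proof
    show "((\<lambda>x. f x \<psi>) has_real_derivative dphi 1 f x \<psi>) (at x)" for x \<psi>
      using deriv[of 0] by simp
    show "\<bar>f x \<psi>\<bar> \<le> 1" for x \<psi> using bound[of 0] by simp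
    show "torus_fun (f x)" for x using f by (simp add: B_space_def torus3_fun_def)
    show "\<phi>m \<le> Sm" unfolding assms(12)
      by (rule cINF_greatest) (use S in \<open>auto intro: less_imp_le\<close>)
    show "SM \<le> \<phi>M" unfolding assms(13)
      by (rule cSUP_least) (use S in \<open>auto intro: less_imp_le\<close>)
    show "0 < f x \<psi>" if x: "x \<in> {\<phi>m..<Sm}" for x \<psi>
    \<comment> \<open>Since \<open>f\<close> is positive at \<phi>m, a nonpositive value to the left
      of \<open>Sm\<close> would force a zero there; by uniqueness it equals
      \<open>S \<psi>\<close>, which is at least \<open>Sm\<close>. The other side is
      symmetric.\<close>
    proof (rule ccontr)
      assume "\<not> 0 < f x \<psi>"
      then obtain s where s: "\<phi>m \<le> s" "s \<le> x" "f s \<psi> = 0"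
        using IVT2'[of "\<lambda>x. f x \<psi>" x 0 \<phi>m] assms(8)[of \<psi>] x contx by force
      then have "s \<noteq> \<phi>m" "s < \<phi>M" using assms(8)[of \<psi>] x S_bounds(1)[of \<psi>] S[of \<psi>] by auto
      then have "s = S \<psi>" using s uniq by auto
      then show False using s x S_bounds(1)[of \<psi>] by simp
    qed
    show "f x \<psi> < 0" if x: "x \<in> {SM<..\<phi>M}" for x \<psi>
    proof (rule ccontr)
      assume "\<not> f x \<psi> < 0"
      then obtain s where s: "x \<le> s" "s \<le> \<phi>M" "f s \<psi> = 0"
        using IVT2'[of "\<lambda>x. f x \<psi>" \<phi>M 0 x] assms(9)[of \<psi>] x contx by force
      then have "s \<noteq> \<phi>M" "\<phi>m < s" using assms(9)[of \<psi>] x S_bounds(2)[of \<psi>] S[of \<psi>] by auto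
      then have "s = S \<psi>" using s uniq by auto
      then show False using s x S_bounds(2)[of \<psi>] by simp
    qed
    show "dphi 1 f x \<psi> \<le> - \<gamma>" if x: "x \<in> {Sm..SM}" for x \<psi>
    proof -
      have "bdd_above ((\<lambda>(x, \<psi>). dphi 1 f x \<psi>) ` ({Sm..SM} \<times> UNIV))"
        using bound[of 1] by (auto intro!: bdd_aboveI[of _ 1] simp: abs_le_iff)
      then have "(case (x, \<psi>) of (x, \<psi>) \<Rightarrow> dphi 1 f x \<psi>) \<le> (SUP (x, \<psi>)\<in>{Sm..SM} \<times> UNIV. dphi 1 f x \<psi>)"
        using x by (intro cSUP_upper) auto
      then show ?thesis by (simp add: assms(14))
    qed
  qed (use assms cont lip[of 1] bound[of 1] in auto)
  show ?thesis
    by (rule exponential_convergence) (use assms in auto)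
qed

end
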